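(* Let $w\in c_1$ have (unique) reduced expression $w=s_1s_2\cdots s_n$ with $\{s_1,s_2,s_3\}=S$, and let $u\in(c_0)^w_3$. Then $\mu(u,w)\neq0$ if and only if $|L(u)|=|R(u)|=2$, $s_1\in L(u)$, $s_n\in R(u)$, $s_2\notin L(u)$ and $s_{n-1}\notin R(u)$. Moreover, in that case $\mu(u,w)=1$.
   Context: $W$ is the affine Weyl group of type $\widetilde A_2$: the Coxeter group on $S=\{r,s,t\}$ with $(rs)^3=(st)^3=(rt)^3=1$, with length $l$ and Bruhat order $\le$. For $u<w$, $\mu(u,w)$ is the coefficient of $q^{(l(w)-l(u)-1)/2}$ in the Kazhdan–Lusztig polynomial $P_{u,w}$. $c_1$ is the set of elements $w\neq e$ having a unique reduced expression (the two-sided cell of $\mathbf a$-value 1), and $c_0=W\setminus(\{e\}\cup c_1)$ (the two-sided cell of $\mathbf a$-value 3). For $w\in W$, $L(w)=\{\sigma\in S:\sigma w<w\}$, $R(w)=\{\sigma\in S: w\sigma<w\}$, and $(c_0)^w_3=\{u\in c_0: u<w,\ l(w)-l(u)=3\}$. *)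

theory Defs
  imports "HOL-Computational_Algebra.Polynomial" "HOL-Library.Poly_Mapping"
begin

section \<open>The affine Weyl group of type $\widetilde A_2$\<close>

datatype letter = Lr | Ls | Lt

text \<open>The congruence on words that presents the Coxeter group: squares of letters, and
  \<open>(ab)\<^sup>3\<close> for distinct letters, are trivial. Since letters are involutions, the resulting
  monoid is the group with this presentation.\<close>

inductive cox_eq :: "letter list \<Rightarrow> letter list \<Rightarrow> bool" where
  refl: "cox_eq xs xs"
| sym: "cox_eq xs ys \<Longrightarrow> cox_eq ys xs"
| trans: "cox_eq xs ys \<Longrightarrow> cox_eq ys zs \<Longrightarrow> cox_eq xs zs"
| square: "cox_eq (xs @ [a, a] @ ys) (xs @ ys)"
| order3: "a \<noteq> b \<Longrightarrow> cox_eq (xs @ [a, b, a, b, a, b] @ ys) (xs @ ys)"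

lemma equivp_cox_eq: "equivp cox_eq"
  by (rule equivpI) (auto intro!: reflpI sympI transpI intro: cox_eq.intros)

lemma cox_eq_append_left: "cox_eq xs ys \<Longrightarrow> cox_eq (zs @ xs) (zs @ ys)"
proof (induction rule: cox_eq.induct)
  case (square xs a ys)
  show ?case using cox_eq.square[of "zs @ xs" a ys] by simp
next
  case (order3 a b xs ys)
  then show ?case using cox_eq.order3[of a b "zs @ xs" ys] by simp
qed (blast intro: cox_eq.intros)+

lemma cox_eq_append_right: "cox_eq xs ys \<Longrightarrow> cox_eq (xs @ zs) (ys @ zs)"
proof (induction rule: cox_eq.induct)
  case (square xs a ys)
  show ?case using cox_eq.square[of xs a "ys @ zs"] by simp
next
  case (order3 a b xs ys)
  then show ?case using cox_eq.order3[of a b xs "ys @ zs"] by simp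
qed (blast intro: cox_eq.intros)+

lemma cox_eq_rev: "cox_eq xs ys \<Longrightarrow> cox_eq (rev xs) (rev ys)"
proof (induction rule: cox_eq.induct)
  case (square xs a ys)
  show ?case using cox_eq.square[of "rev ys" a "rev xs"] by simp
next
  case (order3 a b xs ys)
  then show ?case using cox_eq.order3[of b a "rev ys" "rev xs"] by simp
qed (blast intro: cox_eq.intros)+

lemma cox_eq_rev_append: "cox_eq (rev xs @ xs) []"
proof (induction xs)
  case Nil
  show ?case by (simp add: cox_eq.refl)
next
  case (Cons a xs)
  have "cox_eq (rev xs @ [a, a] @ xs) (rev xs @ xs)" by (rule cox_eq.square)
  with Cons show ?case by (auto intro: cox_eq.trans)
qed

quotient_type weyl = "letter list" / cox_eq
  by (rule equivp_cox_eq)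

instantiation weyl :: monoid_mult
begin

lift_definition one_weyl :: weyl is "[]" .

lift_definition times_weyl :: "weyl \<Rightarrow> weyl \<Rightarrow> weyl" is "(@)"
  by (meson cox_eq.trans cox_eq_append_left cox_eq_append_right)

instance
  by standard (transfer, simp add: cox_eq.refl)+

end

lift_definition gen :: "letter \<Rightarrow> weyl" is "\<lambda>a. [a]" .

lift_definition winv :: "weyl \<Rightarrow> weyl" is rev
  by (rule cox_eq_rev)

lemma winv_left: "winv w * w = 1"
  by transfer (rule cox_eq_rev_append)

lemma winv_right: "w * winv w = 1"
  by transfer (metis cox_eq_rev_append rev_rev_ident)

definition simple_refls :: "weyl set" where
  "simple_refls = {gen Lr, gen Ls, gen Lt}"

definition len :: "weyl \<Rightarrow> nat" where
  "len w = (LEAST n. \<exists>xs. set xs \<subseteq> simple_refls \<and> prod_list xs = w \<and> length xs = n)"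

definition reduced_expr :: "weyl list \<Rightarrow> weyl \<Rightarrow> bool" where
  "reduced_expr xs w \<longleftrightarrow> set xs \<subseteq> simple_refls \<and> prod_list xs = w \<and> length xs = len w"

definition reflections :: "weyl set" where
  "reflections = {x * s * winv x | x s. s \<in> simple_refls}"

definition bruhat_step :: "weyl \<Rightarrow> weyl \<Rightarrow> bool" where
  "bruhat_step x y \<longleftrightarrow> (\<exists>t \<in> reflections. y = x * t) \<and> len x < len y"

lemma bruhat_steps_len: "bruhat_step\<^sup>*\<^sup>* x y \<Longrightarrow> x = y \<or> len x < len y"
  by (induction rule: rtranclp_induct) (auto simp: bruhat_step_def)

text \<open>The order instance on \<open>weyl\<close> is the Bruhat order.\<close>

instantiation weyl :: order
begin

definition less_eq_weyl :: "weyl \<Rightarrow> weyl \<Rightarrow> bool" where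
  "x \<le> y \<longleftrightarrow> bruhat_step\<^sup>*\<^sup>* x y"

definition less_weyl :: "weyl \<Rightarrow> weyl \<Rightarrow> bool" where
  "x < y \<longleftrightarrow> x \<le> y \<and> x \<noteq> (y :: weyl)"

instance
proof
  fix x y z :: weyl
  show "x \<le> y \<Longrightarrow> y \<le> x \<Longrightarrow> x = y"
    unfolding less_eq_weyl_def by (auto dest!: bruhat_steps_len)
  show "x < y \<longleftrightarrow> x \<le> y \<and> \<not> y \<le> x"
    unfolding less_weyl_def less_eq_weyl_def
    by (metis bruhat_steps_len order_less_asym rtranclp.rtrancl_refl)
  show "x \<le> x" unfolding less_eq_weyl_def by simp
  show "x \<le> y \<Longrightarrow> y \<le> z \<Longrightarrow> x \<le> z" unfolding less_eq_weyl_def by simp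
qed

end

definition left_desc :: "weyl \<Rightarrow> weyl set" where
  "left_desc w = {s \<in> simple_refls. s * w < w}"

definition right_desc :: "weyl \<Rightarrow> weyl set" where
  "right_desc w = {s \<in> simple_refls. w * s < w}"

definition cell1 :: "weyl set" where
  "cell1 = {w. w \<noteq> 1 \<and> (\<exists>!xs. reduced_expr xs w)}"

definition cell0 :: "weyl set" where
  "cell0 = UNIV - ({1} \<union> cell1)"

definition cell0_below :: "weyl \<Rightarrow> nat \<Rightarrow> weyl set" where
  "cell0_below w k = {u \<in> cell0. u < w \<and> int (len w) - int (len u) = int k}"


section \<open>The Hecke algebra\<close>

text \<open>Laurent polynomials over the integers in \<open>v = q\<^sup>1\<^sup>/\<^sup>2\<close>, as the group ring of the
  integers: \<open>vpow k\<close> is \<open>v\<^sup>k\<close>.\<close>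

type_synonym laurent = "int \<Rightarrow>\<^sub>0 int"

definition vpow :: "int \<Rightarrow> laurent" where
  "vpow k = Poly_Mapping.single k 1"

definition hecke_q :: laurent where
  "hecke_q = vpow 2"

definition laurent_bar :: "laurent \<Rightarrow> laurent" where
  "laurent_bar = Poly_Mapping.map_key uminus"

text \<open>The Hecke algebra is the free module over the Laurent polynomials with basis
  \<open>hecke_T w\<close>, \<open>w\<close> ranging over the group.\<close>

type_synonym hecke = "weyl \<Rightarrow>\<^sub>0 laurent"

definition hecke_T :: "weyl \<Rightarrow> hecke" where
  "hecke_T w = Poly_Mapping.single w 1"

definition scale :: "laurent \<Rightarrow> hecke \<Rightarrow> hecke" where
  "scale a h = Poly_Mapping.map (\<lambda>c. a * c) h"

definition lin_ext :: "(weyl \<Rightarrow> hecke) \<Rightarrow> hecke \<Rightarrow> hecke" where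
  "lin_ext f h = (\<Sum>x \<in> Poly_Mapping.keys h. scale (Poly_Mapping.lookup h x) (f x))"

definition Ts_mult :: "weyl \<Rightarrow> hecke \<Rightarrow> hecke" where
  "Ts_mult s = lin_ext (\<lambda>w. if len w < len (s * w) then hecke_T (s * w)
                      else scale hecke_q (hecke_T (s * w)) + scale (hecke_q - 1) (hecke_T w))"

text \<open>Multiplication: \<open>hecke_T x\<close> is the product of the \<open>hecke_T s\<close> along a reduced
  expression of \<open>x\<close>. By the braid relations the result does not depend on the expression that is chosen.\<close>

definition T_mult :: "weyl \<Rightarrow> hecke \<Rightarrow> hecke" where
  "T_mult x h = foldr Ts_mult (SOME xs. reduced_expr xs x) h"

definition hecke_mult :: "hecke \<Rightarrow> hecke \<Rightarrow> hecke" where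
  "hecke_mult g h = lin_ext (\<lambda>x. T_mult x h) g"

definition T_inverse :: "weyl \<Rightarrow> hecke" where
  "T_inverse w = (THE h. hecke_mult h (hecke_T w) = hecke_T 1 \<and> hecke_mult (hecke_T w) h = hecke_T 1)"

definition hecke_bar :: "hecke \<Rightarrow> hecke" where
  "hecke_bar h = (\<Sum>x \<in> Poly_Mapping.keys h.
     scale (laurent_bar (Poly_Mapping.lookup h x)) (T_inverse (winv x)))"


section \<open>Kazhdan-Lusztig polynomials\<close>

definition eval_q :: "int poly \<Rightarrow> laurent" where
  "eval_q p = poly (map_poly of_int p) hecke_q"

text \<open>\<open>kl_basis w p\<close> is \<open>q\<^sup>-\<^sup>l\<^sup>(\<^sup>w\<^sup>)\<^sup>/\<^sup>2\<close> times the sum of \<open>p y hecke_T y\<close> over \<open>y \<le> w\<close>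
  (a finite set, by the subword property).\<close>

definition kl_basis :: "weyl \<Rightarrow> (weyl \<Rightarrow> int poly) \<Rightarrow> hecke" where
  "kl_basis w p = (\<Sum>y \<in> {y. y \<le> w}. scale (vpow (- int (len w)) * eval_q (p y)) (hecke_T y))"

text \<open>The conditions that determine \<open>y \<mapsto> P\<^sub>y\<^sub>,\<^sub>w\<close>.\<close>

definition is_kl :: "weyl \<Rightarrow> (weyl \<Rightarrow> int poly) \<Rightarrow> bool" where
  "is_kl w p \<longleftrightarrow>
     p w = 1 \<and>
     (\<forall>y. \<not> y \<le> w \<longrightarrow> p y = 0) \<and>
     (\<forall>y. y < w \<longrightarrow> 2 * int (degree (p y)) \<le> int (len w) - int (len y) - 1) \<and>
     hecke_bar (kl_basis w p) = kl_basis w p"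

definition kl_poly :: "weyl \<Rightarrow> weyl \<Rightarrow> int poly" where
  "kl_poly y w = (THE p. is_kl w p) y"

text \<open>When the length difference is even, the exponent \<open>(l(w) - l(u) - 1)/2\<close> is not an integer
  and there is no such coefficient.\<close>

definition kl_mu :: "weyl \<Rightarrow> weyl \<Rightarrow> int" where
  "kl_mu u w = (if odd (len w - len u) then coeff (kl_poly u w) ((len w - len u - 1) div 2) else 0)"

end

theory Submission
  imports Defs
begin

text \<open>Multiplying the Kazhdan-Lusztig basis element of \<open>x\<close> by that of a generator \<open>a\<close> with
  \<open>a x > x\<close> gives, for \<open>a u < u\<close>, the recursion
  \<open>[q] P(u, a x) = [q] P(a u, x) + [u \<le> x] - |{z < x : l(z) = l(x) - 1, a z < z, u \<le> z}|\<close>.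
  An element of the cell \<open>c\<^sub>1\<close> is an alternating product \<open>a b c a b c \<dots>\<close>. Iterating the recursion
  along it with the lifting property of the Bruhat order shows that, for \<open>u\<close> in \<open>c\<^sub>0\<close> three steps
  below \<open>w\<close>, the coefficient is 1 if \<open>L(u) = {a, c}\<close> and \<open>u\<close> lies below \<open>w\<close> with its first two
  letters deleted, and 0 otherwise. In coordinates on alcoves the elements with
  \<open>L(u) = {a, c}\<close> form a sector; linear bounds on the coordinates of all elements below an
  alternating product single out one alcove of the sector, and it is the one that the conditions
  on the right descents describe.\<close>

section \<open>Length, inversions and the Bruhat order\<close>

text \<open>The recursion for u in c_0 passes to \<open>a u\<close>, which may leave c_0, so the
  coefficient is determined for every u three steps below an alternating product. This adds one
  family with value 1: the alternating product with the same beginning and three letters fewer. It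
  lies in c_1 and drops out at the end. If a is in L(u), the subtracted set has at most one element,
  the product x with its second letter deleted, and it cancels [u \<le> x] unless L(u) = {a, c} or u
  has length 1. What survives is an inequality in the Bruhat order, whereas the theorem speaks of
  right descents. An alcove of odd length in the sector has two wall distances i and j with l(u) =
  2(i + j) + 3. The coordinate bounds give i \<le> 1 for u below w and i = 0 for u below the
  shortened product, and the one letter outside R(u) is the last but one letter of w exactly when 3
  divides i. An alcove of even length fails the inequality and has a single right descent.\<close>

lemma gen_sq [simp]: "gen a * gen a = 1"
  by transfer (use cox_eq.square[of "[]" _ "[]"] in simp)

lemma gen_sq_assoc [simp]: "gen a * (gen a * x) = x"
  by (simp flip: mult.assoc)

lemma gen_braid:
  assumes "a \<noteq> b" shows "gen a * gen b * gen a = gen b * gen a * gen b"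
proof -
  have "gen a * gen b * gen a * gen b * gen a * gen b = 1"
    using assms by transfer (use cox_eq.order3[of _ _ "[]" "[]"] in simp)
  then have "gen a * gen b * gen a * (gen b * gen a * gen b) = 1"
    by (simp add: mult.assoc)
  then have "gen a * gen b * gen a * (gen b * gen a * gen b) * (gen b * gen a * gen b) = gen b * gen a * gen b"
    by simp
  then show ?thesis by (simp add: mult.assoc)
qed

lemma gen_braid_assoc:
  assumes "a \<noteq> b" shows "gen a * (gen b * (gen a * x)) = gen b * (gen a * (gen b * x))"
  using arg_cong[OF gen_braid[OF assms], of "\<lambda>y. y * x"] by (simp add: mult.assoc)

lemma winv_cancel [simp]: "winv x * (x * y) = y" "x * (winv x * y) = y"
  by (simp_all flip: mult.assoc add: winv_left winv_right)

lemma winv_one [simp]: "winv 1 = 1"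
  by (metis mult.right_neutral winv_left)

lemma winv_eqI: "x * y = 1 \<Longrightarrow> winv x = y"
  by (metis mult.right_neutral winv_cancel(1))

lemma winv_winv [simp]: "winv (winv x) = x"
  by (rule winv_eqI) (rule winv_left)

lemma winv_mult: "winv (x * y) = winv y * winv x"
  by (rule winv_eqI) (simp add: mult.assoc winv_right)

lemma winv_gen [simp]: "winv (gen a) = gen a"
  by (rule winv_eqI) simp

lemma gen_mult_eq_iff: "gen a * x = y \<longleftrightarrow> x = gen a * y"
  by (metis gen_sq_assoc)

definition word :: "letter list \<Rightarrow> weyl" where
  "word xs = prod_list (map gen xs)"

lemma word_simps [simp]:
  "word [] = 1" "word (a # xs) = gen a * word xs" "word (xs @ ys) = word xs * word ys"
  by (simp_all add: word_def)

lemma abs_weyl_eq_word: "abs_weyl xs = word xs"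
proof (induction xs)
  case Nil
  show ?case by (simp add: one_weyl.abs_eq)
next
  case (Cons a xs)
  have "abs_weyl (a # xs) = gen a * abs_weyl xs"
    by (simp add: gen.abs_eq times_weyl.abs_eq)
  then show ?case using Cons by simp
qed

lemma word_surj: "\<exists>xs. w = word xs"
  using abs_weyl_eq_word by (metis Quotient_weyl Quotient_def)

lemma simple_refls_eq: "simple_refls = range gen"
  unfolding simple_refls_def by (auto, metis letter.exhaust)

lemma simple_list_eq: "set xs \<subseteq> simple_refls \<longleftrightarrow> (\<exists>ys. xs = map gen ys)"
  by (metis ex_map_conv simple_refls_eq subset_code(1) rangeE rangeI)

text \<open>Letters replace generators from here on. Two letters could a priori define the same
  generator; only the coordinates separate them later, so this passage rests on surjectivity
  alone.\<close>

lemma len_eq_Least: "len w = (LEAST n. \<exists>xs. word xs = w \<and> length xs = n)"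
  unfolding len_def simple_list_eq word_def
  by (rule arg_cong[where f = Least]) (auto simp: fun_eq_iff)

lemma reduced_word: obtains xs where "word xs = w" "length xs = len w"
proof -
  have "\<exists>n xs. word xs = w \<and> length xs = n" using word_surj by metis
  from LeastI_ex[OF this] show thesis using that unfolding len_eq_Least by blast
qed

lemma len_word_le: "len (word xs) \<le> length xs"
  unfolding len_eq_Least by (rule Least_le) auto

lemma len_1 [simp]: "len 1 = 0"
  using len_word_le[of "[]"] by simp

lemma len_eq_0 [simp]: "len w = 0 \<longleftrightarrow> w = 1"
  by (metis len_1 length_0_conv reduced_word word_simps(1))

lemma len_gen_mult_le: "len (gen a * w) \<le> Suc (len w)"
  by (metis len_word_le length_Cons reduced_word word_simps(2))

lemma len_mult_gen_le: "len (w * gen a) \<le> Suc (len w)"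
proof -
  obtain xs where "word xs = w" "length xs = len w" by (rule reduced_word)
  then show ?thesis using len_word_le[of "xs @ [a]"] by simp
qed

text \<open>All relators have even length. This sign character is what excludes equal lengths of
  \<open>w\<close> and \<open>gen a * w\<close>.\<close>

lift_definition even_elt :: "weyl \<Rightarrow> bool" is "\<lambda>xs. even (length xs)"
proof -
  fix xs ys assume "cox_eq xs ys"
  then show "even (length xs) = even (length ys)"
    by induction auto
qed

lemma even_elt_word: "even_elt (word xs) = even (length xs)"
  by (metis abs_weyl_eq_word even_elt.abs_eq)

lemma even_len: "even (len w) = even_elt w"
  by (metis even_elt_word reduced_word)

lemma even_elt_mult: "even_elt (x * y) = (even_elt x = even_elt y)"
  by transfer auto

lemma even_elt_gen [simp]: "\<not> even_elt (gen a)"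
  by transfer simp

lemma len_gen_mult_cases:
  obtains "len (gen a * w) = Suc (len w)" | "len w = Suc (len (gen a * w))"
proof -
  have "even (len (gen a * w)) \<noteq> even (len w)"
    by (simp add: even_len even_elt_mult)
  moreover have "len (gen a * w) \<le> Suc (len w)" by (rule len_gen_mult_le)
  moreover have "len w \<le> Suc (len (gen a * w))"
    using len_gen_mult_le[of a "gen a * w"] by simp
  ultimately show thesis
    using that
    by (metis le_SucE le_antisym)
qed

lemma mult_gen_gen [simp]: "w * gen a * gen a = w"
  by (simp add: mult.assoc)

lemma len_mult_gen_cases:
  obtains "len (w * gen a) = Suc (len w)" | "len w = Suc (len (w * gen a))"
proof -
  have "even (len (w * gen a)) \<noteq> even (len w)"
    by (simp add: even_len even_elt_mult)
  moreover have "len (w * gen a) \<le> Suc (len w)" by (rule len_mult_gen_le)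
  moreover have "len w \<le> Suc (len (w * gen a))"
    using len_mult_gen_le[of "w * gen a" a] by simp
  ultimately show thesis
    using that
    by (metis le_SucE le_antisym)
qed

lemma ex_left_descent:
  assumes "w \<noteq> 1" obtains a where "len w = Suc (len (gen a * w))"
proof -
  obtain xs where xs: "word xs = w" "length xs = len w" by (rule reduced_word)
  with assms obtain a ys where "xs = a # ys" by (cases xs) auto
  with xs have "gen a * w = word ys" by auto
  then have "len (gen a * w) < len w"
    using len_word_le[of ys] xs \<open>xs = a # ys\<close> by simp
  then show thesis using that len_gen_mult_cases[of a w] by (metis not_less_eq less_not_sym lessI)
qed

lemma ex_right_descent:
  assumes "w \<noteq> 1" obtains a where "len w = Suc (len (w * gen a))"
proof -
  obtain xs where xs: "word xs = w" "length xs = len w" by (rule reduced_word)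
  with assms obtain a ys where "xs = ys @ [a]" by (cases xs rule: rev_cases) auto
  with xs have "w * gen a = word ys" by auto
  then have "len (w * gen a) < len w"
    using len_word_le[of ys] xs \<open>xs = ys @ [a]\<close> by simp
  then show thesis using that len_mult_gen_cases[of w a] by (metis not_less_eq less_not_sym lessI)
qed

lemma left_induct [case_names one step]:
  assumes "P 1"
    and "\<And>a x. len (gen a * x) = Suc (len x) \<Longrightarrow> P x \<Longrightarrow> P (gen a * x)"
  shows "P w"
proof (induction "len w" arbitrary: w rule: less_induct)
  case less
  show ?case
  proof (cases "w = 1")
    case False
    then obtain a where "len w = Suc (len (gen a * w))" by (rule ex_left_descent)
    then show ?thesis using assms(2)[of a "gen a * w"] less[of "gen a * w"] by simp
  qed (simp add: assms)
qed

lemma right_induct [case_names one step]: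
  assumes "P 1"
    and "\<And>x a. len (x * gen a) = Suc (len x) \<Longrightarrow> P x \<Longrightarrow> P (x * gen a)"
  shows "P w"
proof (induction "len w" arbitrary: w rule: less_induct)
  case less
  show ?case
  proof (cases "w = 1")
    case False
    then obtain a where "len w = Suc (len (w * gen a))" by (rule ex_right_descent)
    then show ?thesis using assms(2)[of "w * gen a" a] less[of "w * gen a"] by simp
  qed (simp add: assms)
qed

text \<open>The parity with which \<open>t\<close> occurs among the reflections
  \<open>s\<^sub>1 \<dots> s\<^bsub>i-1\<^esub> s\<^sub>i s\<^bsub>i-1\<^esub> \<dots> s\<^sub>1\<close> of a word depends on the group element only.\<close>

primrec word_inversion :: "letter list \<Rightarrow> weyl \<Rightarrow> bool" where
  "word_inversion [] t = False"
| "word_inversion (a # xs) t = ((t = gen a) \<noteq> word_inversion xs (gen a * t * gen a))"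

lemma word_inversion_append:
  "word_inversion (xs @ ys) t =
    (word_inversion xs t \<noteq> word_inversion ys (winv (word xs) * t * word xs))"
proof (induction xs arbitrary: t)
  case Nil
  show ?case by simp
next
  case (Cons a xs)
  have "winv (gen a * word xs) = winv (word xs) * gen a" by (simp add: winv_mult)
  then show ?case using Cons by (auto simp: mult.assoc)
qed

lemma conj_gen_eq_iff: "gen a * t * gen a = x \<longleftrightarrow> t = gen a * x * gen a"
  by (metis gen_sq_assoc mult.assoc mult_gen_gen)

lemma word_inversion_cox_eq:
  assumes "cox_eq xs ys" shows "word_inversion xs t = word_inversion ys t"
proof -
  have trivial_factor: "word_inversion (xs @ zs @ ys) t = word_inversion (xs @ ys) t"
    if "word zs = 1" "\<And>t. \<not> word_inversion zs t" for xs zs ys t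
    using that by (simp add: word_inversion_append)
  show ?thesis using assms
  proof (induction arbitrary: t)
    case (square xs a ys)
    show ?case by (rule trivial_factor) (simp_all add: conj_gen_eq_iff)
  next
    case (order3 a b xs ys)
    then have b: "gen a * (gen b * (gen a * x)) = gen b * (gen a * (gen b * x))" for x
      by (rule gen_braid_assoc)
    have "gen a * (gen b * gen a) = gen b * (gen a * gen b)"
      using gen_braid[OF order3] by (simp add: mult.assoc)
    note b = b this
    show ?case
      by (rule trivial_factor) (simp add: b, simp add: conj_gen_eq_iff, simp add: mult.assoc b, argo)
  qed auto
qed

lift_definition inversion :: "weyl \<Rightarrow> weyl \<Rightarrow> bool" is word_inversion
  by (auto simp: word_inversion_cox_eq)

lemma inversion_word: "inversion (word xs) t = word_inversion xs t"
  by (metis abs_weyl_eq_word inversion.abs_eq)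

lemma inversion_1 [simp]: "\<not> inversion 1 t"
  using inversion_word[of "[]"] by simp

text \<open>The cocycle identity: the inversion set of a product is the symmetric difference of that
  of \<open>x\<close> and the conjugate by \<open>x\<close> of that of \<open>y\<close>. All later
  facts on inversions are computed from it.\<close>

lemma inversion_mult:
  "inversion (x * y) t = (inversion x t \<noteq> inversion y (winv x * t * x))"
proof -
  obtain xs ys where "x = word xs" "y = word ys" using word_surj by blast
  then show ?thesis by (simp flip: word_simps(3) add: inversion_word word_inversion_append)
qed

lemma inversion_gen [simp]: "inversion (gen a) t \<longleftrightarrow> t = gen a"
  using inversion_word[of "[a]"] by simp

lemma inversion_gen_mult:
  "inversion (gen a * x) t = ((t = gen a) \<noteq> inversion x (gen a * t * gen a))"
  by (simp add: inversion_mult)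

text \<open>Strong exchange: an odd number of occurrences of \<open>t\<close> means at least one,
  and left multiplication by \<open>t\<close> deletes the letter at which it occurs.\<close>

lemma inversion_imp_len_less:
  assumes "inversion w t" shows "len (t * w) < len w"
proof -
  have deletion: "\<exists>ys. t * word xs = word ys \<and> length ys < length xs"
    if "word_inversion xs t" for xs t
    using that
  proof (induction xs arbitrary: t)
    case (Cons a xs)
    show ?case
    proof (cases "t = gen a")
      case True
      then have "t * word (a # xs) = word xs" by simp
      then show ?thesis by auto
    next
      case False
      with Cons obtain ys where ys: "gen a * t * gen a * word xs = word ys" "length ys < length xs"
        by fastforce
      then have "t * word (a # xs) = word (a # ys)"
        by (metis gen_sq_assoc mult.assoc word_simps(2))
      then show ?thesis using ys(2) by (metis Suc_mono length_Cons)
    qed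
  qed simp
  obtain xs where xs: "word xs = w" "length xs = len w" by (rule reduced_word)
  with assms deletion[of xs t] obtain ys where "t * w = word ys" "length ys < len w"
    by (auto simp flip: inversion_word)
  then show ?thesis using len_word_le[of ys] by simp
qed

lemma gen_in_reflections [simp]: "gen a \<in> reflections"
  unfolding reflections_def simple_refls_eq
  by (rule CollectI, rule exI[of _ 1]) auto

lemma conj_reflection: "t \<in> reflections \<Longrightarrow> x * t * winv x \<in> reflections"
proof -
  assume "t \<in> reflections"
  then obtain y s where t: "t = y * s * winv y" "s \<in> simple_refls" by (auto simp: reflections_def)
  have "x * t * winv x = (x * y) * s * winv (x * y)" using t by (simp add: winv_mult mult.assoc)
  then show ?thesis using t(2) unfolding reflections_def by blast
qed

lemma reflection_sq: "t \<in> reflections \<Longrightarrow> t * t = 1"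
  by (auto simp: reflections_def simple_refls_eq mult.assoc winv_right)

text \<open>For \<open>t = x * gen a * winv x\<close> the contributions of \<open>x\<close> and
  \<open>winv x\<close> agree, by the cocycle identity for \<open>x * winv x = 1\<close>, so they
  cancel and only the middle letter counts.\<close>

lemma inversion_reflection_self:
  assumes "t \<in> reflections" shows "inversion t t"
proof -
  obtain x a where t: "t = x * gen a * winv x"
    using assms by (auto simp: reflections_def simple_refls_eq)
  have conj: "winv x * t * x = gen a" by (simp add: t mult.assoc winv_left)
  have "inversion (x * winv x) t = (inversion x t \<noteq> inversion (winv x) (gen a))"
    unfolding inversion_mult conj ..
  then have "inversion x t = inversion (winv x) (gen a)" by (simp add: winv_right)
  moreover have "inversion t t = (inversion x t \<noteq> inversion (gen a * winv x) (gen a))"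
    using inversion_mult[of x "gen a * winv x" t] unfolding conj by (simp add: t mult.assoc)
  ultimately show ?thesis by (simp add: inversion_gen_mult)
qed

text \<open>\<open>t\<close> is an inversion of exactly one of \<open>w\<close> and
  \<open>t * w\<close>, so strong exchange applied to both gives the converse as well.\<close>

lemma inversion_iff_len_less:
  assumes "t \<in> reflections" shows "inversion w t \<longleftrightarrow> len (t * w) < len w"
proof -
  have "winv t = t" using reflection_sq[OF assms] by (rule winv_eqI)
  then have "inversion (t * w) t \<longleftrightarrow> \<not> inversion w t"
    using assms by (simp add: inversion_mult inversion_reflection_self reflection_sq)
  moreover have "t * (t * w) = w" using reflection_sq[OF assms] by (simp flip: mult.assoc)
  ultimately show ?thesis
    using inversion_imp_len_less[of w t] inversion_imp_len_less[of "t * w" t] by fastforce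
qed

lemma inversion_gen_iff: "inversion w (gen a) \<longleftrightarrow> len (gen a * w) < len w"
  by (simp add: inversion_iff_len_less)

text \<open>The length conditions make \<open>gen a\<close> an inversion of exactly one of
  \<open>w\<close> and \<open>w * gen b\<close>. By the cocycle identity the only reflection whose
  status changes is \<open>w * gen b * winv w\<close>.\<close>

lemma exchange_left_right:
  assumes "len (gen a * w) = len (w * gen b)" "len (gen a * w * gen b) = len w"
  shows "gen a * w = w * gen b"
proof -
  have "inversion (w * gen b) (gen a) \<noteq> inversion w (gen a)"
    using assms unfolding inversion_gen_iff
    by (metis len_gen_mult_cases lessI less_not_refl mult.assoc not_less_iff_gr_or_eq)
  then have "winv w * gen a * w = gen b" by (auto simp: inversion_mult)
  then show ?thesis by (metis mult.assoc winv_cancel(2))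
qed

section \<open>The lifting property of the Bruhat order\<close>

lemma bruhat_step_iff: "bruhat_step x y \<longleftrightarrow> (\<exists>t \<in> reflections. y = t * x) \<and> len x < len y"
proof -
  have "(\<exists>t \<in> reflections. y = x * t) \<longleftrightarrow> (\<exists>t \<in> reflections. y = t * x)"
  proof safe
    fix t assume t: "t \<in> reflections"
    show "\<exists>t'\<in>reflections. x * t = t' * x"
      by (rule bexI[OF _ conj_reflection[OF t, of x]]) (simp add: mult.assoc winv_left)
    show "\<exists>t'\<in>reflections. t * x = x * t'"
      by (intro bexI[OF _ conj_reflection[OF t, of "winv x"]]) (simp add: mult.assoc)
  qed
  then show ?thesis by (simp add: bruhat_step_def)
qed

text \<open>Passing from \<open>x\<close> to \<open>gen a * x\<close> conjugates the inversions by
  \<open>gen a\<close> and otherwise changes only the status of \<open>gen a\<close>. The excluded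
  case \<open>gen a * x = y\<close> is the one where the reflection is \<open>gen a\<close>
  itself.\<close>

lemma bruhat_step_gen_mult:
  assumes "bruhat_step x y" "gen a * x \<noteq> y" shows "bruhat_step (gen a * x) (gen a * y)"
proof -
  obtain t where t: "t \<in> reflections" "y = t * x" "len x < len y"
    using assms by (auto simp: bruhat_step_iff)
  have t': "gen a * t * gen a \<in> reflections"
    using conj_reflection[OF t(1), of "gen a"] by simp
  have "t * y = x" using t reflection_sq[OF t(1)] by (simp flip: mult.assoc)
  then have "\<not> inversion x t"
    using t by (simp add: inversion_iff_len_less)
  moreover have "gen a * t * gen a \<noteq> gen a"
    using assms(2) t(2) by (auto simp: conj_gen_eq_iff)
  ultimately have "\<not> inversion (gen a * x) (gen a * t * gen a)"
    by (simp add: inversion_gen_mult) (simp add: mult.assoc)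
  moreover have eq: "gen a * y = (gen a * t * gen a) * (gen a * x)"
    by (simp add: t mult.assoc)
  ultimately have "\<not> len (gen a * y) < len (gen a * x)"
    using t' by (simp add: inversion_iff_len_less)
  \<comment> \<open>Reflections are odd, so the two lengths cannot coincide and the weak inequality
    becomes strict.\<close>
  moreover have "even (len (gen a * y)) \<noteq> even (len (gen a * x))"
  proof -
    have "even_elt (winv z) = even_elt z" for z by transfer simp
    then have "\<not> even_elt t" using t(1)
      by (auto simp: reflections_def simple_refls_eq even_elt_mult)
    then show ?thesis by (simp add: even_len even_elt_mult t)
  qed
  ultimately show ?thesis using t' eq unfolding bruhat_step_iff
    by (metis linorder_neqE_nat)
qed

text \<open>Multiplied by \<open>gen a\<close>, a chain remains a chain up to its first step that is
  itself multiplication by \<open>gen a\<close>; there the shifted chain meets the original one. The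
  mirrored lemma below uses the last such step.\<close>

lemma gen_mult_le_cases_left:
  assumes "x \<le> (y :: weyl)" shows "gen a * x \<le> gen a * y \<or> gen a * x \<le> y"
  using assms unfolding less_eq_weyl_def
proof (induction rule: converse_rtranclp_induct)
  case (step x x')
  then show ?case
    by (cases "gen a * x = x'") (auto intro: bruhat_step_gen_mult converse_rtranclp_into_rtranclp)
qed auto

lemma gen_mult_le_cases_right:
  assumes "x \<le> (y :: weyl)" shows "gen a * x \<le> gen a * y \<or> x \<le> gen a * y"
  using assms unfolding less_eq_weyl_def
proof (induction rule: rtranclp_induct)
  case (step y y')
  then show ?case
    by (cases "gen a * y = y'") (use bruhat_step_gen_mult[of y y' a]
        in \<open>auto intro: rtranclp.rtrancl_into_rtrancl\<close>)
qed auto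

lemma bruhat_le_len: "x \<le> (y :: weyl) \<Longrightarrow> len x \<le> len y"
  unfolding less_eq_weyl_def using bruhat_steps_len by fastforce

lemma bruhat_le_len_eq: "x \<le> (y :: weyl) \<Longrightarrow> len y \<le> len x \<Longrightarrow> x = y"
  unfolding less_eq_weyl_def using bruhat_steps_len by fastforce

lemma bruhat_less_len: "x < (y :: weyl) \<Longrightarrow> len x < len y"
  by (metis bruhat_le_len_eq leI less_le)

lemma gen_mult_le_iff: "gen a * w \<le> w \<longleftrightarrow> len (gen a * w) < len w"
proof
  assume "len (gen a * w) < len w"
  then have "bruhat_step (gen a * w) w"
    unfolding bruhat_step_iff by (auto intro!: bexI[of _ "gen a"])
  then show "gen a * w \<le> w" by (auto simp: less_eq_weyl_def)
next
  assume "gen a * w \<le> w"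
  then have "len (gen a * w) \<le> len w" by (rule bruhat_le_len)
  then show "len (gen a * w) < len w" by (cases rule: len_gen_mult_cases[of a w]) auto
qed

lemma le_gen_mult_iff: "w \<le> gen a * w \<longleftrightarrow> len w < len (gen a * w)"
  using gen_mult_le_iff[of a "gen a * w"] by simp

definition ldesc :: "weyl \<Rightarrow> letter set" where
  "ldesc w = {a. len (gen a * w) < len w}"

lemma len_gen_mult_ldesc: "a \<in> ldesc w \<Longrightarrow> len w = Suc (len (gen a * w))"
  by (cases rule: len_gen_mult_cases[of a w]) (auto simp: ldesc_def)

lemma len_gen_mult_not_ldesc: "a \<notin> ldesc w \<Longrightarrow> len (gen a * w) = Suc (len w)"
  by (cases rule: len_gen_mult_cases[of a w]) (auto simp: ldesc_def)

lemma ldesc_gen_mult: "a \<in> ldesc (gen a * w) \<longleftrightarrow> a \<notin> ldesc w"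
  by (cases rule: len_gen_mult_cases[of a w]) (auto simp: ldesc_def)

text \<open>Here and in the lemmas that follow, the lifting property is sorted by left descents: a
  common descent is stripped from both sides, and a descent of the larger element alone is stripped
  from that element only.\<close>

lemma lift_down: "x \<le> w \<Longrightarrow> a \<in> ldesc w \<Longrightarrow> a \<in> ldesc x \<Longrightarrow> gen a * x \<le> gen a * w"
  using gen_mult_le_cases_right[of x w a] gen_mult_le_iff[of a x] by (auto simp: ldesc_def)

lemma lift_strip: "x \<le> w \<Longrightarrow> a \<in> ldesc w \<Longrightarrow> a \<notin> ldesc x \<Longrightarrow> x \<le> gen a * w"
  using gen_mult_le_cases_right[of x w a] le_gen_mult_iff[of x a] len_gen_mult_not_ldesc[of a x]
  by auto

lemma lift_up: "x \<le> w \<Longrightarrow> a \<notin> ldesc w \<Longrightarrow> gen a * x \<le> gen a * w"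
  using gen_mult_le_cases_left[of x w a] le_gen_mult_iff[of w a] len_gen_mult_not_ldesc[of a w]
  by auto

lemma lift_absorb: "x \<le> w \<Longrightarrow> a \<in> ldesc w \<Longrightarrow> gen a * x \<le> w"
  using gen_mult_le_cases_left[of x w a] gen_mult_le_iff[of a w] by (auto simp: ldesc_def)

lemma lift_weaken: "x \<le> w \<Longrightarrow> a \<notin> ldesc w \<Longrightarrow> x \<le> gen a * w"
  using le_gen_mult_iff[of w a] len_gen_mult_not_ldesc[of a w] by auto

lemma le_gen_multD: "x \<le> gen a * w \<Longrightarrow> a \<notin> ldesc w \<Longrightarrow> x \<le> w \<or> gen a * x \<le> w"
  using lift_down[of x "gen a * w" a] lift_strip[of x "gen a * w" a] by (auto simp: ldesc_gen_mult)

lemma finite_bruhat_le: "finite {y. y \<le> (w :: weyl)}"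
proof (rule finite_subset)
  show "{y. y \<le> w} \<subseteq> word ` {xs. set xs \<subseteq> UNIV \<and> length xs \<le> len w}"
  proof
    fix y assume "y \<in> {y. y \<le> w}"
    then have "len y \<le> len w" by (simp add: bruhat_le_len)
    moreover obtain xs where "word xs = y" "length xs = len y" by (rule reduced_word)
    ultimately show "y \<in> word ` {xs. set xs \<subseteq> UNIV \<and> length xs \<le> len w}" by auto
  qed
  have "finite (UNIV :: letter set)"
    by (rule finite_subset[of _ "{Lr, Ls, Lt}"]) (use letter.exhaust in auto)
  then show "finite (word ` {xs. set xs \<subseteq> UNIV \<and> length xs \<le> len w})"
    by (intro finite_imageI finite_lists_length_le)
qed

section \<open>Alcove coordinates\<close>

text \<open>\<open>pt w\<close> lists the values of the three simple affine roots, scaled so that they add up to 3,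
  at the centre of the alcove of \<open>w\<close>.\<close>

definition refl_act :: "letter \<Rightarrow> (letter \<Rightarrow> int) \<Rightarrow> letter \<Rightarrow> int" where
  "refl_act a f x = (if x = a then - f a else f x + f a)"

lemma refl_act_sq: "refl_act a (refl_act a f) = f"
  by (auto simp: refl_act_def fun_eq_iff)

lemma letters_exhaust: "a \<noteq> b \<Longrightarrow> b \<noteq> c \<Longrightarrow> c \<noteq> a \<Longrightarrow> x = a \<or> x = b \<or> x = c" for x :: letter
  by (cases a; cases b; cases c; cases x; simp)

lemma refl_act_order3:
  assumes "a \<noteq> b"
  shows "refl_act a (refl_act b (refl_act a (refl_act b (refl_act a (refl_act b f))))) = f"
  using assms by (auto simp: refl_act_def fun_eq_iff)

lift_definition pt :: "weyl \<Rightarrow> letter \<Rightarrow> int" is "\<lambda>xs. foldr refl_act xs (\<lambda>_. 1)"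
proof -
  fix xs ys assume "cox_eq xs ys"
  then have "foldr refl_act xs f = foldr refl_act ys f" for f
    by (induction arbitrary: f) (auto simp: refl_act_sq refl_act_order3)
  then show "foldr refl_act xs (\<lambda>_. 1) = foldr refl_act ys (\<lambda>_. 1)" .
qed

lemma pt_1 [simp]: "pt 1 x = 1"
  by transfer simp

lemma pt_gen_mult: "pt (gen a * w) = refl_act a (pt w)"
  by transfer simp

lemma pt_gen_mult_simps:
  "pt (gen a * w) a = - pt w a" "x \<noteq> a \<Longrightarrow> pt (gen a * w) x = pt w x + pt w a"
  by (simp_all add: pt_gen_mult refl_act_def)

lemma pt_sum_rst: "pt w Lr + pt w Ls + pt w Lt = 3"
proof (induction w rule: left_induct)
  case (step a x)
  then show ?case by (cases a) (simp_all add: pt_gen_mult_simps)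
qed simp

lemma pt_sum:
  assumes "a \<noteq> b" "b \<noteq> c" "c \<noteq> a" shows "pt w a + pt w b + pt w c = 3"
  using assms pt_sum_rst[of w] by (cases a; cases b; cases c; simp)

text \<open>Negation and the sum of two equal residues both exchange 1 and 2 modulo 3. Hence a
  centre never lies on a wall, and \<open>div 3\<close> counts walls.\<close>

lemma pt_mod3: "pt w x mod 3 = (if even_elt w then 1 else 2)"
proof (induction w arbitrary: x rule: left_induct)
  case one
  have "even_elt 1" by transfer simp
  then show ?case by simp
next
  case (step a w)
  have x: "pt w x mod 3 = (if even_elt w then 1 else 2)"
    and a: "pt w a mod 3 = (if even_elt w then 1 else 2)" by (fact step.IH)+
  show ?case
  proof (cases "x = a")
    case True
    then show ?thesis using a
      by (cases "even_elt w"; simp add: pt_gen_mult_simps even_elt_mult; presburger)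
  next
    case False
    then show ?thesis using x a
      by (cases "even_elt w"; simp add: pt_gen_mult_simps even_elt_mult; presburger)
  qed
qed

lemma pt_nonzero: "pt w x \<noteq> 0"
  using pt_mod3[of w x] by (auto split: if_splits)

text \<open>The usual reduction to a dihedral coset: the coordinate at \<open>a\<close> is a
  nonnegative combination of coordinates at \<open>a\<close> and \<open>b\<close> of an element
  obtained by stripping at most these two letters.\<close>

lemma pt_pos: "a \<notin> ldesc w \<Longrightarrow> pt w a > 0"
proof (induction "len w" arbitrary: w a rule: less_induct)
  case less
  show ?case
  proof (cases "w = 1")
    case False
    then obtain b where b: "len w = Suc (len (gen b * w))" by (rule ex_left_descent)
    define y where "y = gen b * w"
    have w: "w = gen b * y" and y: "len w = Suc (len y)" and bny: "b \<notin> ldesc y"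
      using b by (simp_all add: y_def ldesc_def)
    have ab: "a \<noteq> b" using less.prems b by (auto simp: ldesc_def)
    show ?thesis
    proof (cases "a \<in> ldesc y")
      case False
      then have "pt y a > 0" "pt y b > 0" using less.hyps[of y] y by (auto simp: bny)
      then show ?thesis using ab by (simp add: w pt_gen_mult_simps)
    next
      case True
      define z where "z = gen a * y"
      have yz: "y = gen a * z" and z: "len y = Suc (len z)" and az: "a \<notin> ldesc z"
        using len_gen_mult_ldesc[OF True] True ldesc_gen_mult[of a y] by (simp_all add: z_def)
      \<comment> \<open>Otherwise \<open>w\<close> would have a reduced word starting with b a b,
        hence one starting with a, against the assumption.\<close>
      have "b \<notin> ldesc z"
      proof
        assume bz: "b \<in> ldesc z"
        then have "len z = Suc (len (gen b * z))" by (rule len_gen_mult_ldesc)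
        moreover have "gen a * w = gen b * (gen a * (gen b * z))"
        proof -
          have "gen a * w = gen a * (gen b * (gen a * z))" by (simp add: w yz)
          then show ?thesis using gen_braid_assoc[OF ab, of z] by simp
        qed
        ultimately have "len (gen a * w) \<le> len w"
          using y z len_gen_mult_le[of b "gen a * (gen b * z)"] len_gen_mult_le[of a "gen b * z"]
          by simp
        then show False using len_gen_mult_not_ldesc[OF less.prems] by simp
      qed
      then have "pt z a > 0" "pt z b > 0" using less.hyps[of z] y z az by auto
      then show ?thesis using ab by (simp add: w yz pt_gen_mult_simps)
    qed
  qed simp
qed

lemma ldesc_iff_pt: "a \<in> ldesc w \<longleftrightarrow> pt w a < 0"
proof
  assume "a \<in> ldesc w"
  then have "a \<notin> ldesc (gen a * w)" by (simp add: ldesc_gen_mult)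
  then show "pt w a < 0" using pt_pos[of a "gen a * w"] by (simp add: pt_gen_mult_simps)
qed (use pt_pos in force)

lemma not_ldesc_iff_pt: "a \<notin> ldesc w \<longleftrightarrow> pt w a > 0"
  using ldesc_iff_pt[of a w] pt_nonzero[of w a] by auto

lemma ldesc_empty_iff: "ldesc w = {} \<longleftrightarrow> w = 1"
proof
  assume "ldesc w = {}"
  then show "w = 1" by (metis empty_iff ex_left_descent ldesc_def lessI mem_Collect_eq)
qed (simp add: ldesc_def)

text \<open>The action on alcoves is simply transitive: applying the same letter to both sides
  strips a word of \<open>w\<close>, and an element with no negative coordinate has no left
  descent.\<close>

lemma pt_inject: "pt w = pt w' \<longleftrightarrow> w = w'"
proof
  assume "pt w = pt w'"
  then show "w = w'"
  proof (induction w arbitrary: w' rule: left_induct)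
    case one
    then have "ldesc w' = {}" by (auto simp: ldesc_iff_pt simp flip: one)
    then show ?case by (simp add: ldesc_empty_iff)
  next
    case (step a x)
    have "pt x = pt (gen a * w')" by (metis step.prems gen_sq_assoc pt_gen_mult)
    then show ?case using step.IH by (metis gen_sq_assoc)
  qed
qed simp

lemma gen_inject [simp]: "gen a = gen b \<longleftrightarrow> a = b"
proof
  assume "gen a = gen b"
  then have "pt (gen a * 1) a = pt (gen b * 1) a" by simp
  then show "a = b" unfolding pt_gen_mult by (simp add: refl_act_def split: if_splits)
qed simp

lemma div3_minus:
  fixes x :: int
  assumes "x mod 3 = 1 \<or> x mod 3 = 2"
  shows "(- x) div 3 = - (x div 3) - 1" "(3 - x) div 3 = - (x div 3)"
  using assms by presburger+

text \<open>The length is the number of walls between an alcove and the fundamental one. The terms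
  count the walls in the three directions; the roots take the values 1, 1 and 2 at the identity, all
  strictly between the walls 0 and 3.\<close>

lemma len_pt:
  assumes abc: "a \<noteq> b" "b \<noteq> c" "c \<noteq> a"
  shows "int (len w) = \<bar>pt w a div 3\<bar> + \<bar>pt w b div 3\<bar> + \<bar>(pt w a + pt w b) div 3\<bar>"
proof (induction w rule: left_induct)
  case one
  then show ?case by simp
next
  case (step s x)
  define A B C where "A = pt x a" and "B = pt x b" and "C = pt x c"
  have sum: "A + B + C = 3" using pt_sum[OF abc] by (simp add: A_def B_def C_def)
  have md: "A mod 3 = 1 \<or> A mod 3 = 2" "B mod 3 = 1 \<or> B mod 3 = 2" "C mod 3 = 1 \<or> C mod 3 = 2"
    using pt_mod3[of x a] pt_mod3[of x b] pt_mod3[of x c]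
    unfolding A_def B_def C_def by (simp_all split: if_splits)
  note dm = md[THEN div3_minus(1)] md[THEN div3_minus(2)]
  have ps: "pt x s > 0" using step.hyps by (auto simp: ldesc_def simp flip: not_ldesc_iff_pt)
  have IH: "int (len x) = \<bar>A div 3\<bar> + \<bar>B div 3\<bar> + \<bar>(A + B) div 3\<bar>"
    using step.IH by (simp add: A_def B_def)
  have abs_up: "\<bar>- p - 1\<bar> = \<bar>p\<bar> + 1" "\<bar>p + 1\<bar> = \<bar>p\<bar> + 1" if "p \<ge> 0" for p :: int
    using that by simp_all
  consider "s = a" | "s = b" | "s = c" using letters_exhaust[OF abc] by blast
  then show ?case
  proof cases
    case 1
    then have *: "A > 0" "pt (gen s * x) a = - A" "pt (gen s * x) b = A + B"
      using ps abc by (simp_all add: A_def B_def pt_gen_mult_simps)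
    then have "\<bar>(- A) div 3\<bar> = \<bar>A div 3\<bar> + 1"
      unfolding dm by (intro abs_up) (simp add: pos_imp_zdiv_nonneg_iff)
    moreover have "- A + (A + B) = B" by simp
    ultimately show ?thesis using IH step.hyps unfolding * by (simp only: of_nat_Suc ac_simps)
  next
    case 2
    then have *: "B > 0" "pt (gen s * x) a = A + B" "pt (gen s * x) b = - B"
      using ps abc by (simp_all add: A_def B_def pt_gen_mult_simps)
    then have "\<bar>(- B) div 3\<bar> = \<bar>B div 3\<bar> + 1"
      unfolding dm by (intro abs_up) (simp add: pos_imp_zdiv_nonneg_iff)
    moreover have "A + B + - B = A" by simp
    ultimately show ?thesis using IH step.hyps unfolding * by (simp only: of_nat_Suc ac_simps)
  next
    case 3
    then have *: "C > 0" "pt (gen s * x) a = A + C" "pt (gen s * x) b = B + C"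
      using ps abc by (simp_all add: A_def B_def C_def pt_gen_mult_simps)
    then have "\<bar>(C + 3) div 3\<bar> = \<bar>C div 3\<bar> + 1"
      unfolding div_add_self2[OF zero_neq_numeral[symmetric]]
      by (intro abs_up) (simp add: pos_imp_zdiv_nonneg_iff)
    moreover have "A + C = 3 - B" "B + C = 3 - A" "A + B = 3 - C" "3 - B + (3 - A) = C + 3"
      using sum by simp_all
    ultimately show ?thesis using IH step.hyps unfolding * dm
      by (simp only: of_nat_Suc ac_simps dm abs_minus_cancel)
  qed
qed

lemma not_all_ldesc:
  assumes "a \<noteq> b" "b \<noteq> c" "c \<noteq> a" "a \<in> ldesc w" "b \<in> ldesc w" shows "c \<notin> ldesc w"
  using assms pt_sum[of a b c w] by (auto simp: ldesc_iff_pt)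

text \<open>Since the coordinates add up to 3, that of \<open>gen a * w\<close> at \<open>c\<close>
  is 3 minus the negative number \<open>pt w b\<close>.\<close>

lemma ldesc_gen_mult_two:
  assumes "a \<noteq> b" "b \<noteq> c" "c \<noteq> a" "ldesc w = {a, b}" shows "ldesc (gen a * w) = {b}"
proof -
  have "pt w a < 0" "pt w b < 0" "pt w a + pt w b + pt w c = 3"
    using assms by (auto simp flip: ldesc_iff_pt intro: pt_sum)
  then have "pt (gen a * w) a > 0" "pt (gen a * w) b < 0" "pt (gen a * w) c > 0"
    using assms by (auto simp: pt_gen_mult_simps)
  then have "a \<notin> ldesc (gen a * w)" "b \<in> ldesc (gen a * w)" "c \<notin> ldesc (gen a * w)"
    by (auto simp: ldesc_iff_pt)
  then have "x \<in> ldesc (gen a * w) \<longleftrightarrow> x = b" for x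
    using letters_exhaust[OF assms(1-3), of x] by auto
  then show ?thesis by blast
qed

text \<open>Right multiplication by a generator moves the alcove centre along one of three vectors,
  which the linear part of the left factor permutes up to sign.\<close>

definition third :: "letter \<Rightarrow> letter \<Rightarrow> letter" where
  "third a b = (if a = b then a else if a \<noteq> Lr \<and> b \<noteq> Lr then Lr else if a \<noteq> Ls \<and> b \<noteq> Ls then Ls else Lt)"

lemma third_eq: "a \<noteq> b \<Longrightarrow> b \<noteq> c \<Longrightarrow> c \<noteq> a \<Longrightarrow> third a b = c"
  by (cases a; cases b; cases c; simp add: third_def)

definition edge_vec :: "letter \<Rightarrow> letter \<Rightarrow> int" where
  "edge_vec y x = (if x = y then - 2 else 1)"

lemma refl_act_edge_vec:
  "refl_act a (\<lambda>x. f x + e * edge_vec y x) x = refl_act a f x - e * edge_vec (third a y) x"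
  by (cases a; cases y; cases x; simp add: refl_act_def edge_vec_def third_def)

lemma pt_word_mult_gen:
  "pt (word xs * gen y) x = pt (word xs) x + (- 1) ^ length xs * edge_vec (foldr third xs y) x"
proof (induction xs arbitrary: x)
  case Nil
  have "pt (gen y * 1) x = 1 + edge_vec y x"
    unfolding pt_gen_mult by (simp add: refl_act_def edge_vec_def)
  then show ?case by simp
next
  case (Cons a xs)
  have "pt (word xs * gen y) = (\<lambda>x. pt (word xs) x + (- 1) ^ length xs * edge_vec (foldr third xs y) x)"
    using Cons by auto
  then show ?case
    by (simp add: mult.assoc pt_gen_mult refl_act_edge_vec)
qed

definition letter_index :: "letter \<Rightarrow> letter \<Rightarrow> letter \<Rightarrow> int" where
  "letter_index a b x = (if x = a then 0 else if x = b then 1 else 2)"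

lemma letter_index_third:
  assumes "a \<noteq> b"
  shows "(letter_index a b (third x y) + letter_index a b x + letter_index a b y) mod 3 = 0"
  using assms
  by (cases a; cases b; cases x; cases y; simp add: letter_index_def third_def)

text \<open>Recovers the linear part of an alcove from its coordinates. On indices modulo 3,
  \<open>third x y\<close> is -x - y. As the coordinates are congruent modulo 3, \<open>g\<close> is
  divisible by 3, and the information sits in \<open>g\<close> divided by 3, taken modulo 3; hence
  the factor 3 and the modulus 9.\<close>

lemma letter_index_foldr_third:
  assumes abc: "a \<noteq> b" "b \<noteq> c" "c \<noteq> a"
  defines "g \<equiv> \<lambda>w. pt w b + 2 * pt w c"
  shows "3 * letter_index a b (foldr third xs y) mod 9 =
    (if even (length xs) then 3 * letter_index a b y + 3 - g (word xs)
     else g (word xs) + 3 - 3 * letter_index a b y) mod 9"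
proof (induction xs)
  case Nil
  show ?case by (simp add: g_def)
next
  case (Cons s xs)
  let ?i = "letter_index a b" and ?w = "word xs" and ?y = "foldr third xs y"
  have pt3: "pt ?w x = 3 * (pt ?w x div 3) + (if even (length xs) then 1 else 2)" for x
    using mult_div_mod_eq[of 3 "pt ?w x"] by (simp add: pt_mod3 even_elt_word)
  have t: "(?i (third s ?y) + ?i s + ?i ?y) mod 3 = 0"
    by (rule letter_index_third[OF abc(1)])
  have i: "?i a = 0" "?i b = 1" "?i c = 2" using abc by (auto simp: letter_index_def)
  consider "s = a" | "s = b" | "s = c" using letters_exhaust[OF abc] by blast
  then have "\<exists>k. g (gen s * ?w) = g ?w + 3 * (1 - ?i s) * (if even (length xs) then 1 else -1) + 9 * k"
  proof cases
    case 1
    then have "g (gen s * ?w) = g ?w + 3 * pt ?w a" using abc by (simp add: g_def pt_gen_mult_simps)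
    then show ?thesis using pt3[of a] 1 i
      by (intro exI[of _ "pt ?w a div 3 + (if even (length xs) then 0 else 1)"]) (auto split: if_splits)
  next
    case 2
    then have "g (gen s * ?w) = g ?w" using abc by (simp add: g_def pt_gen_mult_simps)
    then show ?thesis using 2 i by simp
  next
    case 3
    then have "g (gen s * ?w) = g ?w - 3 * pt ?w c" using abc by (simp add: g_def pt_gen_mult_simps)
    then show ?thesis using pt3[of c] 3 i
      by (intro exI[of _ "- (pt ?w c div 3) - (if even (length xs) then 0 else 1)"]) (auto split: if_splits)
  qed
  then obtain k2 where k2: "g (gen s * ?w) = g ?w + 3 * (1 - ?i s) * (if even (length xs) then 1 else -1) + 9 * k2"
    by blast
  obtain k1 where k1: "3 * ?i ?y = (if even (length xs) then 3 * ?i y + 3 - g ?w else g ?w + 3 - 3 * ?i y) + 9 * k1"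
    using Cons.IH by (metis mod_eqE add.commute diff_eq_eq)
  obtain k3 where k3: "?i (third s ?y) + ?i s + ?i ?y = 3 * k3" using t by (metis mod_0_imp_dvd dvdE)
  show ?case
  proof (cases "even (length xs)")
    case True
    then have "3 * ?i (third s ?y) = (g (gen s * ?w) + 3 - 3 * ?i y) + 9 * (k3 - k1 - k2 - 1)"
      using k1 k2 k3 by (simp add: algebra_simps)
    then have "3 * ?i (third s ?y) mod 9 = (g (gen s * ?w) + 3 - 3 * ?i y) mod 9"
      by (simp only: mod_mult_self2)
    then show ?thesis using True by simp
  next
    case False
    then have "3 * ?i (third s ?y) = (3 * ?i y + 3 - g (gen s * ?w)) + 9 * (k3 - k1 + k2 - 1)"
      using k1 k2 k3 by (simp add: algebra_simps)
    then have "3 * ?i (third s ?y) mod 9 = (3 * ?i y + 3 - g (gen s * ?w)) mod 9"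
      by (simp only: mod_mult_self2)
    then show ?thesis using False by simp
  qed
qed

section \<open>The Hecke algebra and the bar involution\<close>

abbreviation cf :: "('a \<Rightarrow>\<^sub>0 'b::zero) \<Rightarrow> 'a \<Rightarrow> 'b" where "cf \<equiv> Poly_Mapping.lookup"

lemma poly_mapping_sum_induct [case_names zero single add]:
  fixes h :: "'a \<Rightarrow>\<^sub>0 'b::comm_monoid_add"
  assumes "P 0" "\<And>k v. P (Poly_Mapping.single k v)" "\<And>g h. P g \<Longrightarrow> P h \<Longrightarrow> P (g + h)"
  shows "P h"
proof (induction h rule: update_induct)
  case (update f a b)
  have "Poly_Mapping.update a b f = Poly_Mapping.single a b + f"
    using update(1)
    by (auto intro!: poly_mapping_eqI simp: lookup_add lookup_update lookup_single when_def in_keys_iff)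
  then show ?case using assms update by simp
qed (fact assms(1))

lemma vpow_mult: "vpow i * vpow j = vpow (i + j)"
  by (simp add: vpow_def mult_single)

lemma vpow_0 [simp]: "vpow 0 = 1"
  by (simp add: vpow_def)

lemma inj_uminus_int: "inj (uminus :: int \<Rightarrow> int)"
  by (simp add: inj_on_def)

lemma lookup_laurent_bar: "cf (laurent_bar a) e = cf a (- e)"
  unfolding laurent_bar_def map_key.rep_eq[OF inj_uminus_int] by simp

lemma laurent_bar_add: "laurent_bar (a + b) = laurent_bar a + laurent_bar b"
  by (rule poly_mapping_eqI) (simp add: lookup_laurent_bar lookup_add)

lemma laurent_bar_diff: "laurent_bar (a - b) = laurent_bar a - laurent_bar b"
  by (rule poly_mapping_eqI) (simp add: lookup_laurent_bar lookup_minus)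

lemma laurent_bar_0 [simp]: "laurent_bar 0 = 0"
  by (rule poly_mapping_eqI) (simp add: lookup_laurent_bar)

lemma laurent_bar_single: "laurent_bar (Poly_Mapping.single k c) = Poly_Mapping.single (- k) c"
  by (rule poly_mapping_eqI) (auto simp add: lookup_laurent_bar lookup_single when_def)

lemma laurent_bar_vpow [simp]: "laurent_bar (vpow k) = vpow (- k)"
  by (simp add: vpow_def laurent_bar_single)

lemma laurent_bar_1 [simp]: "laurent_bar 1 = 1"
  using laurent_bar_vpow[of 0] by simp

lemma laurent_bar_mult: "laurent_bar (a * b) = laurent_bar a * laurent_bar b"
proof (induction a rule: poly_mapping_sum_induct)
  case (single k c)
  show ?case
    by (induction b rule: poly_mapping_sum_induct)
       (simp_all add: mult_single laurent_bar_single laurent_bar_add distrib_left)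
qed (simp_all add: laurent_bar_add distrib_right)

lemma lookup_scale [simp]: "cf (scale a h) x = a * cf h x"
  unfolding scale_def map.rep_eq by (simp add: when_def)

lemma scale_simps [simp]:
  "scale a 0 = 0" "scale 0 h = 0" "scale 1 h = h" "scale a (scale b h) = scale (a * b) h"
  by (rule poly_mapping_eqI, simp add: mult.assoc)+

lemma scale_distribs:
  "scale a (g + h) = scale a g + scale a h" "scale a (g - h) = scale a g - scale a h"
  "scale (a + b) h = scale a h + scale b h" "scale (a - b) h = scale a h - scale b h"
  by (rule poly_mapping_eqI, simp add: algebra_simps lookup_add lookup_minus)+

lemma scale_sum: "scale a (\<Sum>i\<in>I. f i) = (\<Sum>i\<in>I. scale a (f i))"
  by (induction I rule: infinite_finite_induct) (simp_all add: scale_distribs)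

lemma hecke_T_lookup: "cf (hecke_T x) y = (if x = y then 1 else 0)"
  by (simp add: hecke_T_def lookup_single when_def)

lemma single_eq_scale: "Poly_Mapping.single x c = scale c (hecke_T x)"
  by (rule poly_mapping_eqI) (simp add: hecke_T_lookup lookup_single when_def)

text \<open>The twist of the scalars is a parameter so that linear operators and the bar involution
  share one principle: agreement on the standard basis suffices.\<close>

definition semilinear :: "(laurent \<Rightarrow> laurent) \<Rightarrow> (hecke \<Rightarrow> hecke) \<Rightarrow> bool" where
  "semilinear \<phi> F \<longleftrightarrow> (\<forall>g h. F (g + h) = F g + F h) \<and> (\<forall>a h. F (scale a h) = scale (\<phi> a) (F h))"

abbreviation hlinear :: "(hecke \<Rightarrow> hecke) \<Rightarrow> bool" where
  "hlinear \<equiv> semilinear (\<lambda>a. a)"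

lemma semilinearD:
  assumes "semilinear \<phi> F"
  shows "F (g + h) = F g + F h" "F (scale a h) = scale (\<phi> a) (F h)" "F 0 = 0" "F (g - h) = F g - F h"
proof -
  show add: "F (g + h) = F g + F h" for g h using assms by (simp add: semilinear_def)
  show "F (scale a h) = scale (\<phi> a) (F h)" using assms by (simp add: semilinear_def)
  show "F 0 = 0" using add[of 0 0] by simp
  show "F (g - h) = F g - F h" using add[of "g - h" h] by (simp add: algebra_simps)
qed

lemma semilinear_sum:
  assumes "semilinear \<phi> F" shows "F (\<Sum>i\<in>I. f i) = (\<Sum>i\<in>I. F (f i))"
  by (induction I rule: infinite_finite_induct) (simp_all add: semilinearD[OF assms])

lemma semilinear_eqI:
  assumes "semilinear \<phi> F" "semilinear \<phi> G" "\<And>x. F (hecke_T x) = G (hecke_T x)"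
  shows "F h = G h"
proof (induction h rule: poly_mapping_sum_induct)
  case (single x c)
  then show ?case
    by (simp add: single_eq_scale semilinearD[OF assms(1)] semilinearD[OF assms(2)] assms(3))
qed (simp_all add: semilinearD[OF assms(1)] semilinearD[OF assms(2)])

lemma semilinear_compose:
  "semilinear \<phi> F \<Longrightarrow> semilinear \<psi> G \<Longrightarrow> semilinear (\<lambda>a. \<phi> (\<psi> a)) (\<lambda>h. F (G h))"
  by (simp add: semilinear_def)

lemma semilinear_lincomb:
  assumes "semilinear \<phi> F" "semilinear \<phi> G"
  shows "semilinear \<phi> (\<lambda>h. scale a (F h) + scale b (G h))"
  using assms by (simp add: semilinear_def scale_distribs algebra_simps)

lemma hlinear_id: "hlinear (\<lambda>h. h)" by (simp add: semilinear_def)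

lemma semilinear_ext:
  fixes \<phi> :: "laurent \<Rightarrow> laurent" and f :: "weyl \<Rightarrow> hecke"
  assumes "\<And>a b. \<phi> (a + b) = \<phi> a + \<phi> b" "\<And>a b. \<phi> (a * b) = \<phi> a * \<phi> b" "\<phi> 0 = 0" "\<phi> 1 = 1"
  defines "F \<equiv> \<lambda>h. \<Sum>x \<in> Poly_Mapping.keys h. scale (\<phi> (cf h x)) (f x)"
  shows "semilinear \<phi> F" "F (hecke_T x) = f x"
proof -
  \<comment> \<open>The sum may run over any finite set containing the support; with a common set
    additivity holds term by term.\<close>
  have F: "F h = (\<Sum>x\<in>K. scale (\<phi> (cf h x)) (f x))"
    if "finite K" "Poly_Mapping.keys h \<subseteq> K" for K h
    unfolding F_def by (rule sum.mono_neutral_left) (use that in \<open>auto simp: in_keys_iff assms(3)\<close>)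
  have "F (g + h) = F g + F h" for g h
  proof -
    let ?K = "Poly_Mapping.keys g \<union> Poly_Mapping.keys h"
    have "Poly_Mapping.keys (g + h) \<subseteq> ?K" by (rule keys_add)
    then show ?thesis
      by (simp add: F[of ?K] lookup_add assms(1) scale_distribs sum.distrib)
  qed
  moreover have "F (scale a h) = scale (\<phi> a) (F h)" for a h
  proof -
    have "Poly_Mapping.keys (scale a h) \<subseteq> Poly_Mapping.keys h" by (auto simp: in_keys_iff)
    then show ?thesis
      by (simp add: F[of "Poly_Mapping.keys h"] assms(2) scale_sum)
  qed
  ultimately show "semilinear \<phi> F" by (simp add: semilinear_def)
  show "F (hecke_T x) = f x" by (simp add: F[of "{x}"] hecke_T_def assms(4))
qed

lemma lin_ext_linear: "hlinear (lin_ext f)" and lin_ext_T: "lin_ext f (hecke_T x) = f x"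
  using semilinear_ext[where \<phi> = "\<lambda>a. a" and f = f] unfolding lin_ext_def[abs_def] by simp_all

lemma Ts_linear: "hlinear (Ts_mult s)"
  unfolding Ts_mult_def by (rule lin_ext_linear)

lemma Ts_T_up: "a \<notin> ldesc w \<Longrightarrow> Ts_mult (gen a) (hecke_T w) = hecke_T (gen a * w)"
  by (simp add: Ts_mult_def lin_ext_T len_gen_mult_not_ldesc)

lemma Ts_T_down: "a \<in> ldesc w \<Longrightarrow> Ts_mult (gen a) (hecke_T w)
    = scale hecke_q (hecke_T (gen a * w)) + scale (hecke_q - 1) (hecke_T w)"
  by (simp add: Ts_mult_def lin_ext_T ldesc_def)

lemmas Ts_simps = semilinearD[OF Ts_linear]

lemma Ts_quadratic: "Ts_mult (gen a) (Ts_mult (gen a) h)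
    = scale hecke_q h + scale (hecke_q - 1) (Ts_mult (gen a) h)"
proof -
  have "hlinear (\<lambda>h. Ts_mult (gen a) (Ts_mult (gen a) h))"
    by (rule semilinear_compose[OF Ts_linear Ts_linear])
  moreover have "hlinear (\<lambda>h. scale hecke_q h + scale (hecke_q - 1) (Ts_mult (gen a) h))"
    by (rule semilinear_lincomb[OF hlinear_id Ts_linear])
  ultimately show ?thesis
  proof (rule semilinear_eqI)
    fix w
    show "Ts_mult (gen a) (Ts_mult (gen a) (hecke_T w)) =
        scale hecke_q (hecke_T w) + scale (hecke_q - 1) (Ts_mult (gen a) (hecke_T w))"
      by (cases "a \<in> ldesc w")
         (simp_all add: Ts_T_up Ts_T_down Ts_simps ldesc_gen_mult)
  qed
qed

section \<open>Right multiplication and independence of the reduced expression\<close>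

definition Rs_mult :: "weyl \<Rightarrow> hecke \<Rightarrow> hecke" where
  "Rs_mult s = lin_ext (\<lambda>w. if len w < len (w * s) then hecke_T (w * s)
                      else scale hecke_q (hecke_T (w * s)) + scale (hecke_q - 1) (hecke_T w))"

lemma Rs_linear: "hlinear (Rs_mult s)"
  unfolding Rs_mult_def by (rule lin_ext_linear)

lemmas Rs_simps = semilinearD[OF Rs_linear]

lemma Rs_T: "Rs_mult s (hecke_T w) = (if len w < len (w * s) then hecke_T (w * s)
                      else scale hecke_q (hecke_T (w * s)) + scale (hecke_q - 1) (hecke_T w))"
  by (simp add: Rs_mult_def lin_ext_T)

lemma Ts_T: "Ts_mult s (hecke_T w) = (if len w < len (s * w) then hecke_T (s * w)
                      else scale hecke_q (hecke_T (s * w)) + scale (hecke_q - 1) (hecke_T w))"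
  by (simp add: Ts_mult_def lin_ext_T)

text \<open>The critical configuration is l(aw) = l(wb) with l(awb) = l(w), where the exchange lemma
  gives aw = wb. If aw and wb differ, left multiplication by a does not affect whether b lengthens,
  and both orders expand alike.\<close>

lemma Ts_Rs_commute: "Ts_mult (gen a) (Rs_mult (gen b) h) = Rs_mult (gen b) (Ts_mult (gen a) h)"
proof -
  have "hlinear (\<lambda>h. Ts_mult (gen a) (Rs_mult (gen b) h))"
    by (rule semilinear_compose[OF Ts_linear Rs_linear])
  moreover have "hlinear (\<lambda>h. Rs_mult (gen b) (Ts_mult (gen a) h))"
    by (rule semilinear_compose[OF Rs_linear Ts_linear])
  ultimately show ?thesis
  proof (rule semilinear_eqI)
    fix w
    have assoc: "gen a * w * gen b = gen a * (w * gen b)" by (simp add: mult.assoc)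
    show "Ts_mult (gen a) (Rs_mult (gen b) (hecke_T w)) = Rs_mult (gen b) (Ts_mult (gen a) (hecke_T w))"
    proof (cases "gen a * w = w * gen b")
      case True
      then have *: "gen a * (w * gen b) = w" by (metis gen_sq_assoc)
      show ?thesis
        by (cases rule: len_mult_gen_cases[of w b])
           (simp_all add: Rs_T Ts_T Ts_simps Rs_simps True *)
    next
      case False
      then have ex: "\<not> (len (gen a * w) = len (w * gen b) \<and> len (gen a * (w * gen b)) = len w)"
        using exchange_left_right by (auto simp: mult.assoc)
      define k l m where "k = len (gen a * w)" and "l = len (w * gen b)" and "m = len (gen a * (w * gen b))"
      have "k = Suc (len w) \<or> len w = Suc k" "l = Suc (len w) \<or> len w = Suc l"
        "m = Suc l \<or> l = Suc m" "m = Suc k \<or> k = Suc m" "\<not> (k = l \<and> m = len w)"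
        using ex len_gen_mult_cases[of a w] len_mult_gen_cases[of w b]
          len_gen_mult_cases[of a "w * gen b"] len_mult_gen_cases[of "gen a * w" b, unfolded assoc]
        unfolding k_def l_def m_def by blast+
      then have "k < m \<longleftrightarrow> len w < l" "l < m \<longleftrightarrow> len w < k" by auto
      then show ?thesis unfolding k_def l_def m_def
        by (cases "len w < len (gen a * w)"; cases "len w < len (w * gen b)")
           (simp_all add: Rs_T Ts_T Ts_simps Rs_simps assoc scale_distribs algebra_simps)
    qed
  qed
qed

text \<open>Right multiplications produce the whole standard basis from \<open>hecke_T 1\<close>, so
  an operator commuting with them is determined by one value.\<close>

lemma commuting_linear_eqI:
  assumes "hlinear F" "hlinear G" "\<And>b h. F (Rs_mult (gen b) h) = Rs_mult (gen b) (F h)"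
    "\<And>b h. G (Rs_mult (gen b) h) = Rs_mult (gen b) (G h)" "F (hecke_T 1) = G (hecke_T 1)"
  shows "F h = G h"
proof (rule semilinear_eqI[OF assms(1,2)])
  fix w show "F (hecke_T w) = G (hecke_T w)"
  proof (induction w rule: right_induct)
    case (step x b)
    then have "hecke_T (x * gen b) = Rs_mult (gen b) (hecke_T x)" by (simp add: Rs_T)
    then show ?case using step by (simp add: assms(3,4))
  qed (fact assms(5))
qed

lemma reduced_expr_map: "reduced_expr xs w \<longleftrightarrow> (\<exists>ys. xs = map gen ys \<and> word ys = w \<and> length ys = len w)"
  by (auto simp: reduced_expr_def simple_list_eq word_def)

lemma foldr_Ts_linear: "hlinear (foldr Ts_mult xs)"
proof (induction xs)
  case Nil
  show ?case by (simp add: semilinear_def)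
next
  case (Cons s xs)
  then show ?case using semilinear_compose[OF Ts_linear[of s] Cons] by (simp add: comp_def)
qed

lemma foldr_Ts_Rs: "foldr Ts_mult (map gen ys) (Rs_mult (gen b) h) = Rs_mult (gen b) (foldr Ts_mult (map gen ys) h)"
  by (induction ys) (simp_all add: Ts_Rs_commute)

lemma foldr_Ts_one: "length ys = len (word ys) \<Longrightarrow> foldr Ts_mult (map gen ys) (hecke_T 1) = hecke_T (word ys)"
proof (induction ys)
  case (Cons a ys)
  have len: "length ys = len (word ys)" "len (word (a # ys)) = Suc (len (word ys))"
    using Cons.prems len_word_le[of ys] len_gen_mult_le[of a "word ys"] by auto
  then have "a \<notin> ldesc (word ys)" by (simp add: ldesc_def)
  then show ?case using Cons.IH len by (simp add: Ts_T_up)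
qed simp

text \<open>This takes the place of Matsumoto's theorem: the operators of two reduced words commute
  with right multiplications and both send \<open>hecke_T 1\<close> to
  \<open>hecke_T w\<close>.\<close>

lemma T_mult_eq_foldr:
  assumes "reduced_expr xs w" shows "T_mult w h = foldr Ts_mult xs h"
proof -
  have "reduced_expr (SOME xs. reduced_expr xs w) w" using assms by (rule someI)
  then obtain ys where ys: "(SOME xs. reduced_expr xs w) = map gen ys" "word ys = w" "length ys = len w"
    by (auto simp: reduced_expr_map)
  obtain zs where zs: "xs = map gen zs" "word zs = w" "length zs = len w"
    using assms by (auto simp: reduced_expr_map)
  have "foldr Ts_mult (map gen ys) h = foldr Ts_mult (map gen zs) h"
    by (rule commuting_linear_eqI)
       (use ys zs in \<open>simp_all only: foldr_Ts_linear foldr_Ts_Rs foldr_Ts_one\<close>)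
  then show ?thesis using ys zs by (simp add: T_mult_def)
qed

lemma T_mult_1 [simp]: "T_mult 1 h = h"
  using T_mult_eq_foldr[of "[]" 1] by (simp add: reduced_expr_def)

lemma T_mult_up:
  assumes "a \<notin> ldesc w" shows "T_mult (gen a * w) h = Ts_mult (gen a) (T_mult w h)"
proof -
  obtain ys where ys: "word ys = w" "length ys = len w" by (rule reduced_word)
  have "reduced_expr (map gen ys) w" "reduced_expr (map gen (a # ys)) (gen a * w)"
    unfolding reduced_expr_map using ys len_gen_mult_not_ldesc[OF assms]
    by (intro exI[of _ ys] exI[of _ "a # ys"]; simp)+
  then show ?thesis by (simp add: T_mult_eq_foldr)
qed

lemma T_mult_gen: "T_mult (gen a) h = Ts_mult (gen a) h"
  using T_mult_up[of a 1] by (simp add: ldesc_def)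

lemma T_mult_Rs: "T_mult w (Rs_mult (gen b) h) = Rs_mult (gen b) (T_mult w h)"
  by (induction w rule: left_induct) (simp_all add: T_mult_up ldesc_def Ts_Rs_commute)

lemma T_mult_T_1: "T_mult w (hecke_T 1) = hecke_T w"
  by (induction w rule: left_induct) (simp_all add: T_mult_up ldesc_def Ts_T_up)

lemma hecke_mult_linear1: "hlinear (\<lambda>g. hecke_mult g h)"
  unfolding hecke_mult_def by (rule lin_ext_linear)

lemma hecke_mult_T: "hecke_mult (hecke_T w) h = T_mult w h"
  by (simp add: hecke_mult_def lin_ext_T)

lemma hecke_mult_1 [simp]: "hecke_mult (hecke_T 1) h = h" "hecke_mult g (hecke_T 1) = g"
proof -
  show "hecke_mult (hecke_T 1) h = h" by (simp add: hecke_mult_T)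
  show "hecke_mult g (hecke_T 1) = g"
    by (rule semilinear_eqI[OF hecke_mult_linear1 hlinear_id]) (simp add: hecke_mult_T T_mult_T_1)
qed

lemma Ts_hecke_mult: "Ts_mult (gen a) (hecke_mult g h) = hecke_mult (Ts_mult (gen a) g) h"
proof (rule semilinear_eqI[where F = "\<lambda>g. Ts_mult (gen a) (hecke_mult g h)"])
  show "hlinear (\<lambda>g. Ts_mult (gen a) (hecke_mult g h))"
    by (rule semilinear_compose[OF Ts_linear hecke_mult_linear1])
  show "hlinear (\<lambda>g. hecke_mult (Ts_mult (gen a) g) h)"
    by (rule semilinear_compose[OF hecke_mult_linear1 Ts_linear])
  fix w
  show "Ts_mult (gen a) (hecke_mult (hecke_T w) h) = hecke_mult (Ts_mult (gen a) (hecke_T w)) h"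
  proof (cases "a \<in> ldesc w")
    case False
    then show ?thesis by (simp add: Ts_T_up hecke_mult_T T_mult_up)
  next
    case True
    then have "T_mult w h = Ts_mult (gen a) (T_mult (gen a * w) h)"
      using T_mult_up[of a "gen a * w"] by (simp add: ldesc_gen_mult)
    then show ?thesis using True
      by (simp add: Ts_T_down hecke_mult_T Ts_quadratic semilinearD[OF hecke_mult_linear1])
  qed
qed

lemma hecke_mult_assoc: "hecke_mult (hecke_mult f g) h = hecke_mult f (hecke_mult g h)"
proof (rule semilinear_eqI[where F = "\<lambda>f. hecke_mult (hecke_mult f g) h"])
  show "hlinear (\<lambda>f. hecke_mult (hecke_mult f g) h)"
    by (rule semilinear_compose[OF hecke_mult_linear1 hecke_mult_linear1])
  show "hlinear (\<lambda>f. hecke_mult f (hecke_mult g h))" by (rule hecke_mult_linear1)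
  fix w
  show "hecke_mult (hecke_mult (hecke_T w) g) h = hecke_mult (hecke_T w) (hecke_mult g h)"
    unfolding hecke_mult_T
    by (induction w rule: left_induct) (simp_all add: T_mult_up ldesc_def flip: Ts_hecke_mult)
qed

section \<open>Inverses of the standard basis elements and the bar involution\<close>

definition Ts_inv :: "weyl \<Rightarrow> hecke \<Rightarrow> hecke" where
  "Ts_inv s h = scale (vpow (- 2)) (Ts_mult s h) + scale (vpow (- 2) - 1) h"

lemma vpow_q_simps: "vpow (- 2) * hecke_q = 1" "hecke_q * vpow (- 2) = 1"
  by (simp_all add: hecke_q_def vpow_mult)

lemma Ts_inv_linear: "hlinear (Ts_inv s)"
  unfolding Ts_inv_def[abs_def] by (rule semilinear_lincomb[OF Ts_linear hlinear_id])

lemma Ts_inv_Ts: "Ts_inv (gen a) (Ts_mult (gen a) h) = h" "Ts_mult (gen a) (Ts_inv (gen a) h) = h"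
  by (simp_all add: Ts_inv_def Ts_quadratic Ts_simps scale_distribs vpow_q_simps algebra_simps)

lemma len_gen: "len (gen a) = 1"
  using len_gen_mult_cases[of a 1] by auto

text \<open>The condition inside the definite description \<open>T_inverse\<close>; it becomes
  usable once existence, by right induction, and uniqueness, by associativity, are known.\<close>

definition T_inverts :: "hecke \<Rightarrow> weyl \<Rightarrow> bool" where
  "T_inverts h w \<longleftrightarrow> hecke_mult h (hecke_T w) = hecke_T 1 \<and> hecke_mult (hecke_T w) h = hecke_T 1"

lemma T_inverts_unique: "T_inverts g w \<Longrightarrow> T_inverts h w \<Longrightarrow> g = h"
  unfolding T_inverts_def by (metis hecke_mult_1 hecke_mult_assoc)

lemma T_inverse_eqI: "T_inverts h w \<Longrightarrow> T_inverse w = h"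
  unfolding T_inverse_def using T_inverts_unique unfolding T_inverts_def by blast

lemma T_inverts_gen: "T_inverts (Ts_inv (gen a) (hecke_T 1)) (gen a)"
proof -
  have T: "hecke_T (gen a) = Ts_mult (gen a) (hecke_T 1)"
    by (simp add: Ts_T_up ldesc_def)
  have "hecke_mult (Ts_inv (gen a) (hecke_T 1)) h = Ts_inv (gen a) h" for h
    by (simp add: Ts_inv_def semilinearD[OF hecke_mult_linear1] flip: Ts_hecke_mult)
  then show ?thesis
    by (simp add: T_inverts_def T_mult_gen Ts_inv_Ts hecke_mult_T) (simp add: T Ts_inv_Ts)
qed

lemma T_inverts_mult_gen:
  assumes "len (w * gen a) = Suc (len w)" "T_inverts h w"
  shows "T_inverts (Ts_inv (gen a) h) (w * gen a)"
proof -
  let ?i = "Ts_inv (gen a) (hecke_T 1)"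
  have "Ts_inv (gen a) h = hecke_mult ?i h"
    by (simp add: Ts_inv_def semilinearD[OF hecke_mult_linear1] flip: Ts_hecke_mult)
  moreover have "hecke_T (w * gen a) = hecke_mult (hecke_T w) (hecke_T (gen a))"
  proof -
    have T: "hecke_T (gen a) = Rs_mult (gen a) (hecke_T 1)" by (simp add: Rs_T len_gen)
    show ?thesis using assms(1) unfolding hecke_mult_T T T_mult_Rs T_mult_T_1 by (simp add: Rs_T)
  qed
  ultimately show ?thesis
    using assms(2) T_inverts_gen[of a] unfolding T_inverts_def
    by (metis hecke_mult_1 hecke_mult_assoc)
qed

lemma T_inverts_exists: "\<exists>h. T_inverts h w"
proof (induction w rule: right_induct)
  case one
  show ?case by (rule exI[of _ "hecke_T 1"]) (simp add: T_inverts_def)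
qed (use T_inverts_mult_gen in blast)

lemma T_inverse_mult_gen:
  assumes "len (w * gen a) = Suc (len w)"
  shows "T_inverse (w * gen a) = Ts_inv (gen a) (T_inverse w)"
  using T_inverts_exists[of w] T_inverse_eqI T_inverts_mult_gen[OF assms] by metis

lemma T_inverse_1: "T_inverse 1 = hecke_T 1"
  by (rule T_inverse_eqI) (simp add: T_inverts_def)

lemma len_winv [simp]: "len (winv w) = len w"
proof -
  have "len (winv w) \<le> len w" for w
  proof -
    obtain xs where xs: "word xs = w" "length xs = len w" by (rule reduced_word)
    have "winv (word xs) = word (rev xs)" by (induction xs) (simp_all add: winv_mult)
    then show ?thesis using xs len_word_le[of "rev xs"] by simp
  qed
  from this[of w] this[of "winv w"] show ?thesis by simp
qed

text \<open>Inverting a product reverses its factors. Taken at \<open>winv w\<close>, the inverse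
  obeys a recursion along left letters of \<open>w\<close>.\<close>

definition bar_T :: "weyl \<Rightarrow> hecke" where "bar_T w = T_inverse (winv w)"

lemma bar_T_1 [simp]: "bar_T 1 = hecke_T 1"
  by (simp add: bar_T_def T_inverse_1)

lemma bar_T_up:
  assumes "a \<notin> ldesc w" shows "bar_T (gen a * w) = Ts_inv (gen a) (bar_T w)"
proof -
  have "len (winv w * gen a) = len (winv (gen a * w))" by (simp add: winv_mult)
  then have "len (winv w * gen a) = Suc (len (winv w))"
    using len_gen_mult_not_ldesc[OF assms] by (simp only: len_winv)
  then show ?thesis using T_inverse_mult_gen[of "winv w" a] by (simp add: bar_T_def winv_mult)
qed

lemma hecke_bar_semilinear: "semilinear laurent_bar hecke_bar"
  and hecke_bar_T: "hecke_bar (hecke_T w) = bar_T w"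
  using semilinear_ext[where \<phi> = laurent_bar and f = "\<lambda>x. T_inverse (winv x)"]
  unfolding hecke_bar_def[abs_def] bar_T_def
  by (simp_all add: laurent_bar_add laurent_bar_mult)

text \<open>The multiplicativity of the bar involution in the form used here: for a left factor that
  is a generator.\<close>

lemma hecke_bar_Ts: "hecke_bar (Ts_mult (gen a) h) = Ts_inv (gen a) (hecke_bar h)"
proof -
  have "semilinear laurent_bar (\<lambda>h. hecke_bar (Ts_mult (gen a) h))"
    by (rule semilinear_compose[OF hecke_bar_semilinear Ts_linear])
  moreover have "semilinear laurent_bar (\<lambda>h. Ts_inv (gen a) (hecke_bar h))"
    by (rule semilinear_compose[OF Ts_inv_linear hecke_bar_semilinear])
  ultimately show ?thesis
  proof (rule semilinear_eqI)
    fix w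
    show "hecke_bar (Ts_mult (gen a) (hecke_T w)) = Ts_inv (gen a) (hecke_bar (hecke_T w))"
    proof (cases "a \<in> ldesc w")
      case False
      then show ?thesis by (simp add: Ts_T_up hecke_bar_T bar_T_up)
    next
      case True
      then have "bar_T w = Ts_inv (gen a) (bar_T (gen a * w))"
        using bar_T_up[of a "gen a * w"] by (simp add: ldesc_gen_mult)
      then have "bar_T (gen a * w) = Ts_mult (gen a) (bar_T w)" by (simp add: Ts_inv_Ts)
      then show ?thesis using True
        by (simp add: Ts_T_down semilinearD[OF hecke_bar_semilinear] hecke_bar_T Ts_inv_def
            hecke_q_def laurent_bar_diff)
    qed
  qed
qed

text \<open>Left multiplication by the Kazhdan-Lusztig element q^(-1/2) (T_s + 1), which is bar
  invariant.\<close>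

definition Cs_mult :: "weyl \<Rightarrow> hecke \<Rightarrow> hecke" where
  "Cs_mult s h = scale (vpow (- 1)) (Ts_mult s h + h)"

lemma hecke_bar_Cs: "hecke_bar (Cs_mult (gen a) h) = Cs_mult (gen a) (hecke_bar h)"
  by (simp add: Cs_mult_def semilinearD[OF hecke_bar_semilinear] hecke_bar_Ts Ts_inv_def
      scale_distribs vpow_mult algebra_simps)

lemma gen_mult_neq: "gen a * w \<noteq> w" "w \<noteq> gen a * w"
  by (metis len_gen_mult_cases n_not_Suc_n)+

lemma lookup_Ts:
  "cf (Ts_mult (gen a) h) y =
    (if a \<in> ldesc y then cf h (gen a * y) + (hecke_q - 1) * cf h y else hecke_q * cf h (gen a * y))"
proof (induction h rule: poly_mapping_sum_induct)
  case (single w c)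
  show ?case
    by (cases "a \<in> ldesc w"; cases "y = w"; cases "y = gen a * w")
       (auto simp: single_eq_scale Ts_simps Ts_T_up Ts_T_down hecke_T_lookup lookup_add
          ldesc_gen_mult gen_mult_eq_iff gen_mult_neq)
qed (simp_all add: Ts_simps lookup_add algebra_simps)

lemma lookup_Cs:
  "cf (Cs_mult (gen a) h) y = vpow (- 1) *
    (if a \<in> ldesc y then cf h (gen a * y) + hecke_q * cf h y else hecke_q * cf h (gen a * y) + cf h y)"
  by (simp add: Cs_mult_def lookup_add lookup_Ts algebra_simps)

text \<open>Triangularity with respect to length: a further factor \<open>Ts_inv\<close> raises
  lengths by at most one, and the new top term acquires the factor q^(-1) from
  \<open>vpow (- 2)\<close>.\<close>

lemma lookup_bar_T:
  "len w \<le> len y \<Longrightarrow> cf (bar_T w) y = (if y = w then vpow (- 2 * int (len w)) else 0)"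
proof (induction w arbitrary: y rule: left_induct)
  case one
  then show ?case by (simp add: hecke_T_lookup)
next
  case (step a w)
  have bar: "bar_T (gen a * w) = Ts_inv (gen a) (bar_T w)"
    using step.hyps by (intro bar_T_up) (simp add: ldesc_def)
  have y: "len w < len y" using step.prems step.hyps by simp
  then have 0: "cf (bar_T w) y = 0" using step.IH[of y] by auto
  show ?case
  proof (cases "a \<in> ldesc y")
    case True
    then have "len w \<le> len (gen a * y)" using y len_gen_mult_ldesc[OF True] by simp
    then have "cf (bar_T w) (gen a * y) = (if y = gen a * w then vpow (- 2 * int (len w)) else 0)"
      using step.IH[of "gen a * y"] by (simp add: gen_mult_eq_iff)
    then show ?thesis using True 0 step.hyps
      by (simp add: bar Ts_inv_def lookup_add lookup_Ts vpow_mult algebra_simps)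
  next
    case False
    then have "len w < len (gen a * y)" using y len_gen_mult_not_ldesc[OF False] by simp
    then have "cf (bar_T w) (gen a * y) = 0" using step.IH[of "gen a * y"] by auto
    moreover have "y \<noteq> gen a * w" using False step.hyps by (auto simp: ldesc_def)
    ultimately show ?thesis using False 0
      by (simp add: bar Ts_inv_def lookup_add lookup_Ts)
  qed
qed

section \<open>Kazhdan-Lusztig polynomials\<close>

lemma lookup_vpow_mult: "cf (vpow k * x) e = cf x (e - k)"
proof (induction x rule: poly_mapping_sum_induct)
  case (single l c)
  show ?case by (auto simp: vpow_def mult_single lookup_single when_def)
qed (simp_all add: distrib_left lookup_add)

lemma of_int_laurent: "(of_int c :: laurent) = Poly_Mapping.single 0 c"
  by (rule poly_mapping_eqI) (simp add: lookup_of_int lookup_single when_def)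

lemma eval_q_0 [simp]: "eval_q 0 = 0"
  by (simp add: eval_q_def)

lemma eval_q_pCons: "eval_q (pCons c p) = of_int c + hecke_q * eval_q p"
proof -
  have "map_poly of_int (pCons c p) = pCons (of_int c :: laurent) (map_poly of_int p)"
    by (rule map_poly_pCons) simp
  then show ?thesis by (simp add: eval_q_def)
qed

lemma lookup_eval_q: "cf (eval_q p) e = (if e \<ge> 0 \<and> even e then coeff p (nat (e div 2)) else 0)"
proof (induction p arbitrary: e)
  case (pCons c p)
  have IH: "cf (hecke_q * eval_q p) e
    = (if e \<ge> 2 \<and> even e then coeff p (nat ((e - 2) div 2)) else 0)"
    using pCons.IH[of "e - 2"] by (simp add: hecke_q_def lookup_vpow_mult)
  show ?case
  proof (cases "e \<ge> 2 \<and> even e")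
    case True
    then have "nat (e div 2) = Suc (nat ((e - 2) div 2))" by auto
    then show ?thesis using True IH by (simp add: eval_q_pCons lookup_add lookup_of_int)
  next
    case False
    then have "e \<noteq> 0 \<Longrightarrow> e < 0 \<or> odd e" by presburger
    then show ?thesis using False IH
      by (auto simp: eval_q_pCons lookup_add lookup_of_int when_def)
  qed
qed simp

lemma eval_q_diff: "eval_q (p - r) = eval_q p - eval_q r"
  by (rule poly_mapping_eqI) (simp add: lookup_eval_q lookup_minus)

lemma eval_q_add: "eval_q (p + r) = eval_q p + eval_q r"
  by (rule poly_mapping_eqI) (simp add: lookup_eval_q lookup_add)

lemma eval_q_sum: "eval_q (\<Sum>i\<in>I. f i) = (\<Sum>i\<in>I. eval_q (f i))"
  by (induction I rule: infinite_finite_induct) (simp_all add: eval_q_add)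

lemma eval_q_eq_0_iff: "eval_q p = 0 \<longleftrightarrow> p = 0"
proof
  assume "eval_q p = 0"
  then have "coeff p n = 0" for n using lookup_eval_q[of p "2 * int n"] by simp
  then show "p = 0" by (simp add: poly_eq_iff)
qed simp

lemma eval_q_1 [simp]: "eval_q 1 = 1"
  using eval_q_pCons[of 1 0] by (simp add: one_pCons)

lemma eval_q_monom_mult: "eval_q (monom c k * p) = of_int c * vpow (2 * int k) * eval_q p"
proof -
  have c: "cf (of_int c * x :: laurent) e = c * cf x e" for x e
  proof (induction x rule: poly_mapping_sum_induct)
    case (single l d)
    show ?case by (simp add: of_int_laurent mult_single lookup_single when_def)
  qed (simp_all add: distrib_left lookup_add)
  show ?thesis
  proof (rule poly_mapping_eqI)
    fix e :: int
    show "cf (eval_q (monom c k * p)) e = cf (of_int c * vpow (2 * int k) * eval_q p) e"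
    proof (cases "e \<ge> 0 \<and> even e")
      case True
      then obtain n where e: "e = 2 * int n" by (metis dvd_div_mult_self mult.commute nonneg_int_cases
            pos_imp_zdiv_nonneg_iff zero_less_numeral)
      have "(e - 2 * int k) div 2 = int n - int k" "even (e - 2 * int k)" "e - 2 * int k \<ge> 0 \<longleftrightarrow> k \<le> n"
        unfolding e by presburger+
      then have "cf (of_int c * vpow (2 * int k) * eval_q p) e = (if k \<le> n then c * coeff p (n - k) else 0)"
        by (simp add: lookup_eval_q c lookup_vpow_mult mult.assoc nat_diff_distrib)
      moreover have "nat (e div 2) = n" by (simp add: e)
      ultimately show ?thesis using True by (simp add: lookup_eval_q coeff_monom_mult)
    next
      case False
      then show ?thesis
        by (auto simp: lookup_eval_q c lookup_vpow_mult mult.assoc)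
    qed
  qed
qed

lemma laurent_bar_of_int [simp]: "laurent_bar (of_int m) = of_int m"
  by (simp add: of_int_laurent laurent_bar_single)

lemma lookup_kl_basis:
  assumes "\<And>y. \<not> y \<le> w \<Longrightarrow> p y = 0"
  shows "cf (kl_basis w p) y = vpow (- int (len w)) * eval_q (p y)"
proof -
  have "cf (kl_basis w p) y =
      (\<Sum>z\<in>{z. z \<le> w}. if z = y then vpow (- int (len w)) * eval_q (p z) else 0)"
    unfolding kl_basis_def lookup_sum by (rule sum.cong) (auto simp: hecke_T_lookup)
  also have "\<dots> = vpow (- int (len w)) * eval_q (p y)"
    using assms by (simp add: finite_bruhat_le)
  finally show ?thesis .
qed

lemma is_klD:
  assumes "is_kl w p"
  shows "p w = 1" "\<not> y \<le> w \<Longrightarrow> p y = 0"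
    "y \<noteq> w \<Longrightarrow> 2 * int n \<ge> int (len w) - int (len y) \<Longrightarrow> coeff (p y) n = 0"
    "hecke_bar (kl_basis w p) = kl_basis w p"
    "cf (kl_basis w p) y = vpow (- int (len w)) * eval_q (p y)"
proof -
  show "p w = 1" "hecke_bar (kl_basis w p) = kl_basis w p" using assms by (simp_all add: is_kl_def)
  show *: "\<not> y \<le> w \<Longrightarrow> p y = 0" for y using assms by (simp add: is_kl_def)
  show "coeff (p y) n = 0" if "y \<noteq> w" "2 * int n \<ge> int (len w) - int (len y)"
  proof (cases "y \<le> w")
    case True
    then have "2 * int (degree (p y)) \<le> int (len w) - int (len y) - 1"
      using assms that(1) by (auto simp: is_kl_def less_le)
    then show ?thesis using that(2) by (intro coeff_eq_0) linarith
  qed (simp add: *)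
  show "cf (kl_basis w p) y = vpow (- int (len w)) * eval_q (p y)"
    by (rule lookup_kl_basis) (rule *)
qed

lemma is_klI:
  assumes "p w = 1" "\<And>y. \<not> y \<le> w \<Longrightarrow> p y = 0"
    "\<And>y n. y < w \<Longrightarrow> 2 * int n \<ge> int (len w) - int (len y) \<Longrightarrow> coeff (p y) n = 0"
    "hecke_bar (kl_basis w p) = kl_basis w p"
  shows "is_kl w p"
proof -
  have "2 * int (degree (p y)) \<le> int (len w) - int (len y) - 1" if y: "y < w" for y
  proof (cases "p y = 0")
    case True
    have "len y < len w" using y by (rule bruhat_less_len)
    then show ?thesis using True by simp
  next
    case False
    then have "coeff (p y) (degree (p y)) \<noteq> 0" by simp
    then show ?thesis using assms(3)[OF y, of "degree (p y)"] by linarith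
  qed
  then show ?thesis using assms by (simp add: is_kl_def)
qed

text \<open>The bar involution reverses exponents around \<open>- l(y)\<close> in the top coefficient, so a bar
  invariant element whose coefficients only involve exponents below \<open>- l(y)\<close> vanishes.\<close>

lemma bar_invariant_eq_0:
  assumes bar: "hecke_bar h = h"
    and small: "\<And>y e. cf (cf h y) e \<noteq> 0 \<Longrightarrow> e < - int (len y)"
  shows "h = 0"
proof (rule ccontr)
  assume "h \<noteq> 0"
  then have ne: "Poly_Mapping.keys h \<noteq> {}" by simp
  define m where "m = Max (len ` Poly_Mapping.keys h)"
  have "m \<in> len ` Poly_Mapping.keys h" unfolding m_def using ne by (intro Max_in) auto
  then obtain y where y: "y \<in> Poly_Mapping.keys h" "m = len y" by auto
  have max: "len x \<le> len y" if "x \<in> Poly_Mapping.keys h" for x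
    unfolding y(2)[symmetric] m_def using that by (intro Max_ge) auto
  have "cf (hecke_bar h) y = (\<Sum>x\<in>Poly_Mapping.keys h. laurent_bar (cf h x) * cf (bar_T x) y)"
    unfolding hecke_bar_def bar_T_def lookup_sum by simp
  also have "\<dots> = (\<Sum>x\<in>Poly_Mapping.keys h.
      if x = y then laurent_bar (cf h y) * vpow (- 2 * int (len y)) else 0)"
    by (rule sum.cong) (auto simp: lookup_bar_T max)
  also have "\<dots> = laurent_bar (cf h y) * vpow (- 2 * int (len y))" using y(1) by simp
  finally have eq: "cf h y = vpow (- 2 * int (len y)) * laurent_bar (cf h y)"
    by (simp add: bar mult.commute)
  obtain e where e: "cf (cf h y) e \<noteq> 0"
    using y(1) by (metis in_keys_iff lookup_zero poly_mapping_eqI)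
  moreover have "cf (cf h y) e = cf (cf h y) (- 2 * int (len y) - e)"
    by (subst eq) (simp only: lookup_vpow_mult lookup_laurent_bar minus_diff_eq)
  ultimately have "cf (cf h y) (- 2 * int (len y) - e) \<noteq> 0" by simp
  then show False using small[OF e] small[of y "- 2 * int (len y) - e"] by linarith
qed

text \<open>In the difference of two candidates the terms at \<open>w\<close> cancel, and the degree
  bound says that the exponent -l(w) + 2n of every other term is below -l(y).\<close>

lemma is_kl_unique:
  assumes p: "is_kl w p" and r: "is_kl w r" shows "p = r"
proof
  fix y
  define h where "h = kl_basis w p - kl_basis w r"
  have h: "cf h y = vpow (- int (len w)) * eval_q (p y - r y)" for y
    by (simp add: h_def lookup_minus is_klD(5)[OF p] is_klD(5)[OF r] eval_q_diff algebra_simps)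
  have "h = 0"
  proof (rule bar_invariant_eq_0)
    show "hecke_bar h = h"
      by (simp add: h_def semilinearD[OF hecke_bar_semilinear] is_klD(4)[OF p] is_klD(4)[OF r])
    fix y e assume e: "cf (cf h y) e \<noteq> 0"
    define n where "n = nat ((e + int (len w)) div 2)"
    have n: "e + int (len w) = 2 * int n" "coeff (p y - r y) n \<noteq> 0"
      using e unfolding h lookup_vpow_mult lookup_eval_q n_def by (auto split: if_splits)
    have "y \<noteq> w" using n(2) by (auto simp: is_klD(1)[OF p] is_klD(1)[OF r])
    then have "2 * int n < int (len w) - int (len y)"
      using n(2) is_klD(3)[OF p, of y n] is_klD(3)[OF r, of y n] by force
    then show "e < - int (len y)" using n(1) by linarith
  qed
  then have "vpow (int (len w)) * (vpow (- int (len w)) * eval_q (p y - r y)) = 0"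
    using h[of y] by simp
  then have "eval_q (p y - r y) = 0" by (simp add: vpow_mult flip: mult.assoc)
  then show "p y = r y" by (simp add: eval_q_eq_0_iff)
qed

section \<open>Existence by recursion along left multiplication\<close>

definition kl_corr :: "letter \<Rightarrow> weyl \<Rightarrow> weyl set" where
  "kl_corr a x = {z. a \<in> ldesc z \<and> z < x \<and> odd (len x - len z)}"

text \<open>The coefficients of C_a C_x minus the sum of \<mu>(z,x) C_z. The exponent (l(x) + 1 -
  l(z))/2 accounts for the change of normalisation from l(z) to l(ax).\<close>

definition kl_next ::
  "letter \<Rightarrow> weyl \<Rightarrow> (weyl \<Rightarrow> int poly) \<Rightarrow> (weyl \<Rightarrow> weyl \<Rightarrow> int poly) \<Rightarrow> weyl \<Rightarrow> int poly" where
  "kl_next a x p P y =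
    (if a \<in> ldesc y then p (gen a * y) + monom 1 1 * p y else monom 1 1 * p (gen a * y) + p y)
    - (\<Sum>z\<in>kl_corr a x.
        monom (coeff (p z) ((len x - len z - 1) div 2)) ((Suc (len x) - len z) div 2) * P z y)"

lemma finite_kl_corr [simp]: "finite (kl_corr a x)"
  by (rule finite_subset[OF _ finite_bruhat_le[of x]]) (auto simp: kl_corr_def)

text \<open>Bar invariance is inherited from the summands, so the degree bound is the real content.
  It can fail before correction only through q times \<open>p y\<close> with \<open>a\<close> a
  descent of \<open>y\<close>, in a single degree.\<close>

lemma is_kl_next:
  assumes ax: "a \<notin> ldesc x" and p: "is_kl x p" and P: "\<And>z. z < x \<Longrightarrow> is_kl z (P z)"
  shows "is_kl (gen a * x) (kl_next a x p P)"
proof (rule is_klI)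
  let ?w = "gen a * x" and ?Z = "kl_corr a x"
  let ?\<mu> = "\<lambda>z. coeff (p z) ((len x - len z - 1) div 2)" and ?e = "\<lambda>z. (Suc (len x) - len z) div 2"
  have lw: "len ?w = Suc (len x)" using ax by (rule len_gen_mult_not_ldesc)
  have aw: "a \<in> ldesc ?w" using ax by (simp add: ldesc_gen_mult)
  have xw: "x \<le> ?w" using lw by (simp add: le_gen_mult_iff)
  have Z: "z < x" "a \<in> ldesc z" "is_kl z (P z)" "len x + 1 = len z + 2 * ?e z" if "z \<in> ?Z" for z
  proof -
    show z: "z < x" "a \<in> ldesc z" using that by (auto simp: kl_corr_def)
    show "is_kl z (P z)" using z P by simp
    have "odd (len x - len z)" "len z < len x" using that z(1) by (auto simp: kl_corr_def bruhat_less_len)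
    then show "len x + 1 = len z + 2 * ?e z" by presburger
  qed
  show "kl_next a x p P ?w = 1"
  proof -
    have "\<not> ?w \<le> x" using lw bruhat_le_len[of ?w x] by auto
    then have "p ?w = 0" by (rule is_klD(2)[OF p])
    moreover have "P z ?w = 0" if "z \<in> ?Z" for z
      using is_klD(2)[OF Z(3)[OF that], of ?w] Z(1)[OF that] \<open>\<not> ?w \<le> x\<close> by (meson less_le order_trans)
    ultimately show ?thesis using aw by (simp add: kl_next_def is_klD(1)[OF p])
  qed
  show supp: "kl_next a x p P y = 0" if "\<not> y \<le> ?w" for y
  proof -
    have yx: "\<not> y \<le> x" "\<not> gen a * y \<le> x"
      using that xw lift_up[of "gen a * y" x a] ax by auto
    then have "\<not> y \<le> z" if "z \<in> ?Z" for z
      using Z(1)[OF that] by (meson less_le order_trans)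
    with yx show ?thesis by (simp add: kl_next_def is_klD(2)[OF p] is_klD(2)[OF Z(3)])
  qed
  show "coeff (kl_next a x p P y) n = 0" if y: "y < ?w" and n: "2 * int n \<ge> int (len ?w) - int (len y)" for y n
  proof -
    have other: "coeff (monom (?\<mu> z) (?e z) * P z y) n = 0" if "z \<in> ?Z" "z \<noteq> y" for z
      using is_klD(3)[OF Z(3)[OF that(1)], of y "n - ?e z"] that(2) Z(4)[OF that(1)] n lw
      by (auto simp: coeff_monom_mult of_nat_diff)
    show ?thesis
    proof (cases "a \<in> ldesc y")
      case True
      then have len: "len y = Suc (len (gen a * y))" by (rule len_gen_mult_ldesc)
      have yx: "y \<noteq> x" "gen a * y \<noteq> x" using True ax y by (auto simp: gen_mult_eq_iff)
      have p1: "coeff (p (gen a * y)) n = 0"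
        using yx(2) n len lw by (intro is_klD(3)[OF p]) auto
      show ?thesis
      proof (cases "y \<in> ?Z \<and> n = ?e y")
        \<comment> \<open>The critical degree: only the summand z = y reaches it, with
          \<open>P y y = 1\<close>, and its factor is the very coefficient to be removed.\<close>
        case yZ: True
        have "(\<Sum>z\<in>?Z. coeff (monom (?\<mu> z) (?e z) * P z y) n) = coeff (monom (?\<mu> y) (?e y) * P y y) n"
          using yZ other by (subst sum.remove[of _ y]) auto
        also have "\<dots> = ?\<mu> y"
          using yZ is_klD(1)[OF Z(3)] by simp
        also have "\<dots> = coeff (monom 1 1 * p y) n"
        proof -
          have "n = Suc ((len x - len y - 1) div 2)"
            using yZ Z(4)[of y] Z(1)[of y] bruhat_less_len[of y x] by presburger
          then show ?thesis by (simp add: coeff_monom_mult)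
        qed
        finally show ?thesis using True p1 by (simp add: kl_next_def coeff_sum)
      next
        case nZ: False
        have "coeff (monom (?\<mu> z) (?e z) * P z y) n = 0" if z: "z \<in> ?Z" for z
        proof (cases "z = y")
          case True
          then have "n \<noteq> ?e y" using nZ z by auto
          then show ?thesis using True is_klD(1)[OF Z(3)[OF z]] by simp
        qed (use other z in auto)
        moreover have "coeff (monom 1 1 * p y) n = 0"
        proof (rule ccontr)
          assume *: "coeff (monom 1 1 * p y) n \<noteq> 0"
          then obtain m where m: "n = Suc m" "coeff (p y) m \<noteq> 0"
            by (cases n) (auto simp: coeff_monom_mult)
          then have "y < x" using is_klD(2)[OF p, of y] yx(1) by (cases "y \<le> x") (simp_all add: less_le)
          moreover have "\<not> 2 * int m \<ge> int (len x) - int (len y)"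
            using m(2) is_klD(3)[OF p yx(1)] by blast
          ultimately have "len x - len y = 2 * m + 1" "len y < len x"
            using n lw m(1) bruhat_less_len[of y x] by auto
          then have "odd (len x - len y)" "n = ?e y" using m(1) by auto
          then show False using nZ True \<open>y < x\<close> by (simp add: kl_corr_def)
        qed
        ultimately show ?thesis using True p1 by (simp add: kl_next_def coeff_sum)
      qed
    next
      case False
      then have len: "len (gen a * y) = Suc (len y)" by (rule len_gen_mult_not_ldesc)
      have "gen a * y \<noteq> x" using False ax by (auto simp: ldesc_gen_mult)
      then have "coeff (monom 1 1 * p (gen a * y)) n = 0"
        using n len lw is_klD(3)[OF p, of "gen a * y" "n - 1"]
        by (auto simp: coeff_monom_mult)
      moreover have "coeff (p y) n = 0"
      proof (cases "y = x")
        case True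
        then have "n \<noteq> 0" using n lw by auto
        then show ?thesis using True is_klD(1)[OF p] by simp
      next
        case False
        then show ?thesis using n lw by (intro is_klD(3)[OF p]) auto
      qed
      moreover have "z \<in> ?Z \<Longrightarrow> z \<noteq> y" for z using Z(2) False by auto
      ultimately show ?thesis using False other by (simp add: kl_next_def coeff_sum)
    qed
  qed
  have basis: "kl_basis ?w (kl_next a x p P) =
    Cs_mult (gen a) (kl_basis x p) - (\<Sum>z\<in>?Z. scale (of_int (?\<mu> z)) (kl_basis z (P z)))"
  proof (rule poly_mapping_eqI)
    fix y
    have "cf (kl_basis ?w (kl_next a x p P)) y = vpow (- int (len ?w)) * eval_q (kl_next a x p P y)"
      by (rule lookup_kl_basis) (rule supp)
    also have "vpow (- int (len ?w)) * eval_q (kl_next a x p P y) =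
      vpow (- 1) * (vpow (- int (len x)) *
        eval_q (if a \<in> ldesc y then p (gen a * y) + monom 1 1 * p y else monom 1 1 * p (gen a * y) + p y))
      - (\<Sum>z\<in>?Z. vpow (- int (len ?w)) * eval_q (monom (?\<mu> z) (?e z) * P z y))"
    proof -
      have "vpow (- int (len ?w)) = vpow (- 1) * vpow (- int (len x))" by (simp add: vpow_mult lw)
      then show ?thesis
        unfolding kl_next_def eval_q_diff eval_q_sum right_diff_distrib sum_distrib_left
        by (simp only: mult.assoc)
    qed
    also have "(\<Sum>z\<in>?Z. vpow (- int (len ?w)) * eval_q (monom (?\<mu> z) (?e z) * P z y))
      = (\<Sum>z\<in>?Z. of_int (?\<mu> z) * cf (kl_basis z (P z)) y)"
    proof (rule sum.cong)
      have regroup: "A * (M * B * C) = M * (A * B * C)" for A B C M :: laurent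
        by (simp add: ac_simps)
      fix z assume z: "z \<in> ?Z"
      have "- int (len ?w) + 2 * int (?e z) = - int (len z)" using Z(4)[OF z] lw by linarith
      then have "vpow (- int (len ?w)) * vpow (2 * int (?e z)) = vpow (- int (len z))"
        by (simp add: vpow_mult)
      then show "vpow (- int (len ?w)) * eval_q (monom (?\<mu> z) (?e z) * P z y)
        = of_int (?\<mu> z) * cf (kl_basis z (P z)) y"
        unfolding eval_q_monom_mult is_klD(5)[OF Z(3)[OF z]] by (subst regroup) (simp only:)
    qed simp
    also have "vpow (- 1) * (vpow (- int (len x)) *
        eval_q (if a \<in> ldesc y then p (gen a * y) + monom 1 1 * p y else monom 1 1 * p (gen a * y) + p y))
      = cf (Cs_mult (gen a) (kl_basis x p)) y"
    proof -
      have "eval_q (monom 1 1 * r) = hecke_q * eval_q r" for r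
        using eval_q_monom_mult[of 1 1 r] by (simp add: hecke_q_def)
      then show ?thesis
        by (simp only: lookup_Cs is_klD(5)[OF p] eval_q_add if_distrib[of eval_q] distrib_left
            mult.left_commute[of hecke_q] if_distrib[of "(*) (vpow (- int (len x)))"])
    qed
    finally show "cf (kl_basis ?w (kl_next a x p P)) y =
      cf (Cs_mult (gen a) (kl_basis x p) - (\<Sum>z\<in>?Z. scale (of_int (?\<mu> z)) (kl_basis z (P z)))) y"
      by (simp add: lookup_minus lookup_sum)
  qed
  show "hecke_bar (kl_basis ?w (kl_next a x p P)) = kl_basis ?w (kl_next a x p P)"
    unfolding basis
    by (simp add: semilinearD[OF hecke_bar_semilinear] semilinear_sum[OF hecke_bar_semilinear]
        hecke_bar_Cs is_klD(4)[OF p] is_klD(4)[OF Z(3)])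
qed

lemma bruhat_le_1 [simp]: "y \<le> 1 \<longleftrightarrow> y = (1 :: weyl)"
  using bruhat_le_len[of y 1] by auto

lemma is_kl_1: "is_kl 1 (\<lambda>y. if y = 1 then 1 else 0)"
  by (rule is_klI) (auto simp: kl_basis_def hecke_bar_T less_le)

lemma is_kl_exists: "\<exists>p. is_kl w p"
proof (induction "len w" arbitrary: w rule: less_induct)
  case less
  show ?case
  proof (cases "w = 1")
    case False
    then obtain a where a: "len w = Suc (len (gen a * w))" by (rule ex_left_descent)
    define x where "x = gen a * w"
    have "\<exists>p. is_kl z p" if "z \<le> x" for z
      using less a bruhat_le_len[OF that] by (simp add: x_def)
    then obtain P where P: "\<And>z. z \<le> x \<Longrightarrow> is_kl z (P z)" by metis
    have "is_kl (gen a * x) (kl_next a x (P x) P)"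
      by (rule is_kl_next) (use a P in \<open>auto simp: ldesc_def x_def\<close>)
    then show ?thesis by (auto simp: x_def)
  qed (use is_kl_1 in blast)
qed

lemma is_kl_kl_poly: "is_kl w (\<lambda>y. kl_poly y w)"
proof -
  have "is_kl w (THE p. is_kl w p)"
    using is_kl_exists is_kl_unique by (metis theI)
  then show ?thesis by (simp add: kl_poly_def)
qed

lemma kl_poly_gen_mult:
  assumes "a \<notin> ldesc x"
  shows "kl_poly y (gen a * x) = kl_next a x (\<lambda>y. kl_poly y x) (\<lambda>z y. kl_poly y z) y"
  using fun_cong[OF is_kl_unique[OF is_kl_kl_poly is_kl_next[OF assms is_kl_kl_poly is_kl_kl_poly]]] .

lemma kl_poly_not_le: "\<not> y \<le> w \<Longrightarrow> kl_poly y w = 0"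
  using is_klD(2)[OF is_kl_kl_poly] .

text \<open>Corrections carry positive powers of q, so one term of the recursion contributes, and
  the lifting property identifies its condition with \<open>y \<le> gen a * x\<close>.\<close>

lemma coeff_0_kl_poly: "coeff (kl_poly y w) 0 = (if y \<le> w then 1 else 0)"
proof (induction w arbitrary: y rule: left_induct)
  case one
  show ?case using is_klD(1)[OF is_kl_kl_poly[of 1]] by (simp add: kl_poly_not_le)
next
  case (step a x)
  have ax: "a \<notin> ldesc x" using step.hyps by (simp add: ldesc_def)
  have "(Suc (len x) - len z) div 2 \<noteq> 0" if "z \<in> kl_corr a x" for z
    using that bruhat_less_len[of z x] by (auto simp: kl_corr_def)
  then have "coeff (\<Sum>z\<in>kl_corr a x. monom (coeff (kl_poly z x) ((len x - len z - 1) div 2))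
      ((Suc (len x) - len z) div 2) * kl_poly y z) 0 = 0"
    unfolding coeff_sum by (intro sum.neutral) (simp add: coeff_monom_mult)
  then have "coeff (kl_poly y (gen a * x)) 0 =
    (if a \<in> ldesc y then coeff (kl_poly (gen a * y) x) 0 else coeff (kl_poly y x) 0)"
    unfolding kl_poly_gen_mult[OF ax] kl_next_def by (simp add: coeff_monom_mult)
  also have "\<dots> = (if a \<in> ldesc y \<and> gen a * y \<le> x \<or> a \<notin> ldesc y \<and> y \<le> x then 1 else 0)"
    using step.IH by simp
  also have "a \<in> ldesc y \<and> gen a * y \<le> x \<or> a \<notin> ldesc y \<and> y \<le> x \<longleftrightarrow> y \<le> gen a * x"
  proof -
    have "a \<in> ldesc (gen a * x)" using ax by (simp add: ldesc_gen_mult)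
    then show ?thesis
      using lift_down[of y "gen a * x" a] lift_strip[of y "gen a * x" a] lift_up[of "gen a * y" x a]
        lift_weaken[of y x a] ax gen_sq_assoc[of a x] gen_sq_assoc[of a y] by metis
  qed
  finally show ?case .
qed

text \<open>Only corrections from elements one step below \<open>x\<close> carry the first power of
  q; their \<mu> is a constant coefficient, hence 1, so the correction is a cardinality.\<close>

lemma coeff_1_kl_poly_gen_mult:
  assumes ax: "a \<notin> ldesc x"
  shows "coeff (kl_poly u (gen a * x)) 1 =
    (if a \<in> ldesc u then coeff (kl_poly (gen a * u) x) 1 + coeff (kl_poly u x) 0
     else coeff (kl_poly (gen a * u) x) 0 + coeff (kl_poly u x) 1)
    - int (card {z. a \<in> ldesc z \<and> z \<le> x \<and> Suc (len z) = len x \<and> u \<le> z})"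
proof -
  let ?e = "\<lambda>z. (Suc (len x) - len z) div 2" and ?\<mu> = "\<lambda>z. coeff (kl_poly z x) ((len x - len z - 1) div 2)"
  let ?N = "{z. a \<in> ldesc z \<and> z \<le> x \<and> Suc (len z) = len x \<and> u \<le> z}"
  have "(\<Sum>z\<in>kl_corr a x. coeff (monom (?\<mu> z) (?e z) * kl_poly u z) 1)
    = (\<Sum>z\<in>kl_corr a x. if z \<in> ?N then 1 else 0)"
  proof (rule sum.cong)
    fix z assume z: "z \<in> kl_corr a x"
    then have zx: "z < x" "len z < len x" "odd (len x - len z)" "a \<in> ldesc z"
      by (auto simp: kl_corr_def bruhat_less_len)
    show "coeff (monom (?\<mu> z) (?e z) * kl_poly u z) 1 = (if z \<in> ?N then 1 else 0)"
    proof (cases "Suc (len z) = len x")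
      case True
      then have "?e z = 1" "?\<mu> z = 1" using zx(1) by (auto simp: coeff_0_kl_poly simp flip: True)
      then show ?thesis using zx True by (simp add: coeff_monom_mult coeff_0_kl_poly)
    next
      case False
      then have "?e z > 1" using zx(2,3) by presburger
      then show ?thesis using False by (simp add: coeff_monom_mult)
    qed
  qed simp
  also have "\<dots> = int (card (kl_corr a x \<inter> ?N))"
    by (simp add: sum.If_cases)
  also have "kl_corr a x \<inter> ?N = ?N"
  proof -
    have "z \<noteq> x \<and> odd (len x - len z)" if "Suc (len z) = len x" for z
    proof -
      have "len x - len z = 1" using that by simp
      then show ?thesis by auto
    qed
    then show ?thesis by (auto simp: kl_corr_def less_le)
  qed
  finally show ?thesis
    unfolding kl_poly_gen_mult[OF ax] kl_next_def by (simp add: coeff_sum coeff_monom_mult)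
qed

section \<open>Alternating products\<close>

text \<open>The only possible correction is \<open>gen a * u\<close>: it is one step above
  \<open>u\<close> and below every candidate. It cancels the first term of the recursion, and the
  second vanishes by degree.\<close>

lemma coeff_1_kl_poly_nondescent:
  assumes ax: "a \<notin> ldesc x" and au: "a \<notin> ldesc u" and len: "len x = len u + 2"
  shows "coeff (kl_poly u (gen a * x)) 1 = 0"
proof -
  let ?N = "{z. a \<in> ldesc z \<and> z \<le> x \<and> Suc (len z) = len x \<and> u \<le> z}"
  have lau: "len (gen a * u) = Suc (len u)" using au by (rule len_gen_mult_not_ldesc)
  have z: "z = gen a * u" if "a \<in> ldesc z" "Suc (len z) = len x" "u \<le> z" for z
    using lift_absorb[OF that(3,1)] that(2) lau len by (intro bruhat_le_len_eq[symmetric]) auto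
  have "?N = (if gen a * u \<le> x then {gen a * u} else {})"
    using z au lau len by (auto simp: ldesc_gen_mult le_gen_mult_iff)
  moreover have "coeff (kl_poly u x) 1 = 0"
    using len by (intro is_klD(3)[OF is_kl_kl_poly]) auto
  ultimately show ?thesis
    using au unfolding coeff_1_kl_poly_gen_mult[OF ax] by (simp add: coeff_0_kl_poly)
qed

text \<open>Written cyclically because peeling a letter off an alternating product rotates the
  triple.\<close>

definition distinct3 :: "letter \<Rightarrow> letter \<Rightarrow> letter \<Rightarrow> bool" where
  "distinct3 a b c \<longleftrightarrow> a \<noteq> b \<and> b \<noteq> c \<and> c \<noteq> a"

lemma distinct3_rotate: "distinct3 a b c \<Longrightarrow> distinct3 b c a" "distinct3 a b c \<Longrightarrow> distinct3 c a b"
  by (auto simp: distinct3_def)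

lemma distinct3D:
  assumes "distinct3 a b c"
  shows "a \<noteq> b" "b \<noteq> c" "c \<noteq> a" "b \<noteq> a" "c \<noteq> b" "a \<noteq> c"
  using assms by (auto simp: distinct3_def)

lemma distinct3_exhaust: "distinct3 a b c \<Longrightarrow> x = a \<or> x = b \<or> x = c"
  by (auto simp: distinct3_def dest: letters_exhaust)

primrec zigs :: "nat \<Rightarrow> letter \<Rightarrow> letter \<Rightarrow> letter \<Rightarrow> letter list" where
  "zigs 0 a b c = []"
| "zigs (Suc n) a b c = a # zigs n b c a"

definition zig :: "nat \<Rightarrow> letter \<Rightarrow> letter \<Rightarrow> letter \<Rightarrow> weyl" where
  "zig n a b c = word (zigs n a b c)"

lemma zig_0 [simp]: "zig 0 a b c = 1" and zig_Suc: "zig (Suc n) a b c = gen a * zig n b c a"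
  by (simp_all add: zig_def)

lemma length_zigs [simp]: "length (zigs n a b c) = n"
  by (induction n arbitrary: a b c) auto

text \<open>The upper bound 3 is needed for the induction: the new coordinate at \<open>b\<close> is
  3 minus the previous one at \<open>c\<close>. Geometrically the alcoves stay in a strip between
  two parallel walls.\<close>

lemma pt_zig:
  assumes "distinct3 a b c"
  shows "0 < pt (zig n a b c) b \<and> pt (zig n a b c) b < 3 \<and> 0 < pt (zig n a b c) c"
  using assms
proof (induction n arbitrary: a b c)
  case (Suc n)
  note d = distinct3D[OF Suc.prems]
  have "0 < pt (zig n b c a) c \<and> pt (zig n b c a) c < 3 \<and> 0 < pt (zig n b c a) a"
    using Suc distinct3_rotate by blast
  then show ?case using d pt_sum[of a b c "zig n b c a"]
    by (auto simp: zig_Suc pt_gen_mult_simps)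
qed simp

lemma ldesc_zig_subset: "distinct3 a b c \<Longrightarrow> ldesc (zig n a b c) \<subseteq> {a}"
  using pt_zig[of a b c n] distinct3_exhaust[of a b c]
  by (auto simp: ldesc_iff_pt) (metis less_asym)

lemma ldesc_zig_Suc: "distinct3 a b c \<Longrightarrow> ldesc (zig (Suc n) a b c) = {a}"
  using ldesc_zig_subset[of a b c "Suc n"] pt_zig[OF distinct3_rotate(1), of a b c n]
  by (auto simp: zig_Suc ldesc_iff_pt pt_gen_mult_simps)

lemma not_ldesc_zig: "distinct3 a b c \<Longrightarrow> b \<notin> ldesc (zig n a b c)" "distinct3 a b c \<Longrightarrow> c \<notin> ldesc (zig n a b c)"
  using ldesc_zig_subset[of a b c n] by (auto simp: distinct3_def)

lemma len_zig: "distinct3 a b c \<Longrightarrow> len (zig n a b c) = n"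
proof (induction n arbitrary: a b c)
  case (Suc n)
  then show ?case
    using len_gen_mult_ldesc[of a "zig (Suc n) a b c"] distinct3_rotate(1)[of a b c]
    by (simp add: ldesc_zig_Suc) (simp add: zig_Suc)
qed simp

lemma ldesc_two_strip:
  assumes d: "distinct3 a b c" and v: "ldesc v = {a, b}"
  shows "ldesc (gen b * v) = {a}" "b \<in> ldesc (gen a * (gen b * v))"
    "len v = len (gen b * (gen a * (gen b * v))) + 3"
proof -
  note n = distinct3D[OF d]
  show 1: "ldesc (gen b * v) = {a}" by (rule ldesc_gen_mult_two[of b a c]) (use n v in auto)
  have "pt v a < 0" using v by (auto simp flip: ldesc_iff_pt)
  then show 2: "b \<in> ldesc (gen a * (gen b * v))"
    using n by (simp add: ldesc_iff_pt pt_gen_mult_simps)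
  show "len v = len (gen b * (gen a * (gen b * v))) + 3"
    using len_gen_mult_ldesc[of b v] len_gen_mult_ldesc[of a "gen b * v"] len_gen_mult_ldesc[OF 2] 1 v
    by simp
qed

text \<open>Four lifting steps remove b, c, a, b from the product. At c the element on the left has
  only the descent a and stays as it is, so it loses just its initial braid b a b.\<close>

lemma le_zig_two_descents_iff:
  assumes d: "distinct3 a b c" and v: "ldesc v = {a, b}"
  shows "v \<le> zig (Suc (Suc (Suc (Suc j)))) b c a \<longleftrightarrow> gen b * (gen a * (gen b * v)) \<le> zig j c a b"
proof -
  define W1 W2 W3 W4 W5 where "W1 = zig (Suc (Suc (Suc (Suc j)))) b c a" and "W2 = zig (Suc (Suc (Suc j))) c a b"
    and "W3 = zig (Suc (Suc j)) a b c" and "W4 = zig (Suc j) b c a" and "W5 = zig j c a b"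
  have W: "W1 = gen b * W2" "W2 = gen c * W3" "W3 = gen a * W4" "W4 = gen b * W5"
    by (simp_all add: W1_def W2_def W3_def W4_def W5_def zig_Suc)
  have in_desc: "b \<in> ldesc W1" "c \<in> ldesc W2" "a \<in> ldesc W3" "b \<in> ldesc W4"
    unfolding W1_def W2_def W3_def W4_def ldesc_zig_Suc[OF d] ldesc_zig_Suc[OF distinct3_rotate(1)[OF d]]
      ldesc_zig_Suc[OF distinct3_rotate(2)[OF d]] by blast+
  have notin: "b \<notin> ldesc W2" "c \<notin> ldesc W3" "a \<notin> ldesc W4" "b \<notin> ldesc W5"
    unfolding W2_def W3_def W4_def W5_def
    using not_ldesc_zig[OF d] not_ldesc_zig[OF distinct3_rotate(1)[OF d]]
      not_ldesc_zig[OF distinct3_rotate(2)[OF d]] by blast+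
  note s = ldesc_two_strip[OF d v]
  have "v \<le> W1 \<longleftrightarrow> gen b * v \<le> W2"
    using lift_down[of v W1 b] lift_up[of "gen b * v" W2 b] in_desc notin v W by force
  also have "\<dots> \<longleftrightarrow> gen b * v \<le> W3"
    using lift_strip[of "gen b * v" W2 c] lift_weaken[of "gen b * v" W3 c] in_desc notin s(1) W
      distinct3D[OF d] by auto
  also have "\<dots> \<longleftrightarrow> gen a * (gen b * v) \<le> W4"
    using lift_down[of "gen b * v" W3 a] lift_up[of "gen a * (gen b * v)" W4 a] in_desc notin s(1) W by auto
  also have "\<dots> \<longleftrightarrow> gen b * (gen a * (gen b * v)) \<le> W5"
    using lift_down[of "gen a * (gen b * v)" W4 b] lift_up[of "gen b * (gen a * (gen b * v))" W5 b]
      in_desc notin s(2) W by auto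
  finally show ?thesis by (simp add: W1_def W5_def)
qed

text \<open>The product b c a b c a ... of length j + 4 with its second letter deleted; the braid
  that this creates at the front yields two left descents.\<close>

definition zig_top :: "nat \<Rightarrow> letter \<Rightarrow> letter \<Rightarrow> letter \<Rightarrow> weyl" where
  "zig_top j a b c = gen b * (gen a * (gen b * zig j c a b))"

lemma zig_top:
  assumes d: "distinct3 a b c"
  shows "ldesc (zig_top j a b c) = {a, b}" "len (zig_top j a b c) = j + 3"
    "gen b * zig_top j a b c = zig (Suc (Suc j)) a b c"
    "zig_top j a b c \<le> zig (Suc (Suc (Suc (Suc j)))) b c a"
proof -
  note n = distinct3D[OF d]
  show 3: "gen b * zig_top j a b c = zig (Suc (Suc j)) a b c" by (simp add: zig_top_def zig_Suc)
  have "pt (zig j c a b) a > 0" "pt (zig j c a b) b > 0"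
    using pt_zig[OF distinct3_rotate(2)[OF d]] by auto
  then have "a \<in> ldesc (zig_top j a b c)" "b \<in> ldesc (zig_top j a b c)"
    using n by (simp_all add: zig_top_def ldesc_iff_pt pt_gen_mult_simps)
  then show 1: "ldesc (zig_top j a b c) = {a, b}"
    using not_all_ldesc[of a b c] distinct3_exhaust[OF d] n by auto
  show "zig_top j a b c \<le> zig (Suc (Suc (Suc (Suc j)))) b c a"
    unfolding le_zig_two_descents_iff[OF d 1] by (simp add: zig_top_def)
  show "len (zig_top j a b c) = j + 3"
    using ldesc_two_strip(3)[OF d 1] len_zig[OF distinct3_rotate(2)[OF d]] by (simp add: zig_top_def)
qed

text \<open>Without the descent b, the element would be the product with its first letter removed,
  whose only descent is c. With both descents, stripping braids leaves two comparable elements of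
  equal length.\<close>

lemma coatom_zig_two_descents:
  assumes d: "distinct3 a b c" and z: "a \<in> ldesc z" "z \<le> zig (Suc m) b c a" "len z = m" "m \<ge> 1"
  shows "m \<ge> 3 \<and> z = zig_top (m - 3) a b c"
proof -
  note n = distinct3D[OF d]
  have "b \<in> ldesc z"
  proof (rule ccontr)
    assume "b \<notin> ldesc z"
    then have "z \<le> zig m c a b"
      using lift_strip[OF z(2), of b] ldesc_zig_Suc[OF distinct3_rotate(1)[OF d], of m]
      by (simp add: zig_Suc)
    then have "z = zig m c a b"
      using len_zig[OF distinct3_rotate(2)[OF d]] z(3) by (intro bruhat_le_len_eq) auto
    moreover obtain k where "m = Suc k" using z(4) by (cases m) auto
    ultimately show False using z(1) ldesc_zig_Suc[OF distinct3_rotate(2)[OF d]] n by auto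
  qed
  then have l: "ldesc z = {a, b}" using z(1) not_all_ldesc[of a b c] distinct3_exhaust[OF d] n by auto
  define j where "j = m - 3"
  have m: "m = j + 3" using ldesc_two_strip(3)[OF d l] z(3) by (simp add: j_def)
  then have "Suc m = Suc (Suc (Suc (Suc j)))" by simp
  then have "gen b * (gen a * (gen b * z)) \<le> zig j c a b"
    using le_zig_two_descents_iff[OF d l, of j] z(2) by simp
  moreover have "len (gen b * (gen a * (gen b * z))) = j" using ldesc_two_strip(3)[OF d l] z(3) m by simp
  ultimately have "gen b * (gen a * (gen b * z)) = zig j c a b"
    using len_zig[OF distinct3_rotate(2)[OF d], of j] by (intro bruhat_le_len_eq) auto
  then have "z = gen b * (gen a * (gen b * zig j c a b))"
    by (metis gen_sq_assoc)
  then show ?thesis using m by (simp add: zig_top_def)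
qed

text \<open>The first alternative concerns c_1 and is carried along for the induction. The bound 4
  excludes u = 1 below a product of three letters, where the coefficient is 0.\<close>

lemma coeff_1_zig:
  assumes "distinct3 a b c" "u \<le> zig n a b c" "len u + 3 = n"
  shows "coeff (kl_poly u (zig n a b c)) 1 =
    (if 4 \<le> n \<and> u = zig (n - 3) a b c \<or> ldesc u = {a, c} \<and> u \<le> zig (n - 2) c a b then 1 else 0)"
  using assms
proof (induction n arbitrary: a b c u)
  case (Suc m)
  note d = Suc.prems(1) and n = distinct3D[OF Suc.prems(1)]
  note rot = distinct3_rotate[OF d]
  define x where "x = zig m b c a"
  have w: "zig (Suc m) a b c = gen a * x" by (simp add: x_def zig_Suc)
  have ax: "a \<notin> ldesc x" using not_ldesc_zig(2)[OF rot(1)] by (simp add: x_def)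
  have lx: "len x = len u + 2" using Suc.prems(3) by (simp add: x_def len_zig[OF rot(1)])
  obtain k where k: "m = Suc (Suc k)" "len u = k" using Suc.prems(3) by (metis add_2_eq_Suc' add_Suc_right add_left_cancel numeral_2_eq_2 numeral_3_eq_3 nat.inject)
  have x: "x = gen b * zig (Suc k) c a b" "zig (Suc k) c a b = gen c * zig k a b c"
    by (simp_all add: x_def k zig_Suc)
  have bx: "b \<in> ldesc x" by (simp add: x_def k ldesc_zig_Suc[OF rot(1)])
  show ?case
  proof (cases "a \<in> ldesc u")
    case False
    have "ldesc (zig (Suc j) a b c) = {a}" for j by (rule ldesc_zig_Suc[OF d])
    then have "u \<noteq> zig (m - 2) a b c" if "4 \<le> Suc m" using False that k(1)
      by (cases k) auto
    then show ?thesis using False coeff_1_kl_poly_nondescent[OF ax False lx] n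
      unfolding w by auto
  next
    case True
    then have "u \<noteq> 1" by (auto simp: ldesc_def)
    then obtain l where l: "k = Suc l" using k(2) by (cases k) auto
    have lau: "len (gen a * u) = l" using len_gen_mult_ldesc[OF True] k(2) l by simp
    have aux: "gen a * u \<le> x"
      using lift_down[OF Suc.prems(2), of a] True ax by (simp add: w ldesc_gen_mult)
    have mk: "Suc m - 3 = k" "Suc m - 2 = Suc k" using k by simp_all
    define N where "N = {z. a \<in> ldesc z \<and> z \<le> x \<and> Suc (len z) = len x \<and> u \<le> z}"
    have N: "card N = (if 2 \<le> l + 1 \<and> u \<le> zig_top (l - 1) a b c then 1 else 0)"
    proof -
      have coatom: "l \<ge> 1 \<and> z = zig_top (l - 1) a b c" if "z \<in> N" for z
        using that coatom_zig_two_descents[OF d, of z "Suc k"] lx k l by (auto simp: N_def x_def)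
      have "zig_top (l - 1) a b c \<in> N" if "l \<ge> 1" "u \<le> zig_top (l - 1) a b c"
        using that zig_top[OF d, of "l - 1"] lx k l by (auto simp: N_def x_def numeral_eq_Suc)
      then have "N = (if 2 \<le> l + 1 \<and> u \<le> zig_top (l - 1) a b c then {zig_top (l - 1) a b c} else {})"
        using coatom by (auto simp: N_def)
      then show ?thesis by simp
    qed
    have top: "gen b * zig_top (l - 1) a b c = zig k a b c" if "l \<ge> 1"
      using zig_top(3)[OF d, of "l - 1"] that l by simp
    have IH: "coeff (kl_poly (gen a * u) x) 1 =
      (if 1 \<le> l \<and> gen a * u = zig l b c a \<or> ldesc (gen a * u) = {b, a} \<and> gen a * u \<le> zig (m - 2) a b c then 1 else 0)"
      using Suc.IH[OF rot(1) aux[unfolded x_def]] lau k l by (simp add: x_def)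
    have rec: "coeff (kl_poly u (gen a * x)) 1 =
        coeff (kl_poly (gen a * u) x) 1 + (if u \<le> x then 1 else 0) - int (card N)"
      using True unfolding coeff_1_kl_poly_gen_mult[OF ax] by (simp add: coeff_0_kl_poly N_def)
    have anu: "a \<notin> ldesc (gen a * u)" using True by (simp add: ldesc_gen_mult)
    have zigk: "gen a * u = zig l b c a \<longleftrightarrow> u = zig k a b c"
      by (simp add: l zig_Suc gen_mult_eq_iff)
    \<comment> \<open>The length of \<open>u\<close> is one less than that of the coatom, so
      adjoining b to \<open>u\<close> yields the coatom itself.\<close>
    have bu: "u = zig k a b c" if "b \<notin> ldesc u" "u \<le> zig_top (l - 1) a b c" "l \<ge> 1"
    proof -
      have "gen b * u \<le> zig_top (l - 1) a b c" using that zig_top(1)[OF d] by (intro lift_absorb) auto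
      then have "gen b * u = zig_top (l - 1) a b c"
        using zig_top(2)[OF d, of "l - 1"] len_gen_mult_not_ldesc[OF that(1)] k l that(3)
        by (intro bruhat_le_len_eq) auto
      then show ?thesis using top[OF that(3)] by (metis gen_sq_assoc)
    qed
    have uk: "ldesc (zig k a b c) = {a}" by (simp add: l ldesc_zig_Suc[OF d])
    have ux: "u \<le> x \<longleftrightarrow> u \<le> zig (Suc k) c a b" if "b \<notin> ldesc u"
      using lift_strip[of u x b] lift_weaken[of u "zig (Suc k) c a b" b] that bx
        not_ldesc_zig(2)[OF rot(2), of "Suc k"] by (auto simp: x(1))
    have "ldesc u = {a, b} \<or> ldesc u = {a, c} \<or> ldesc u = {a}"
      using True not_all_ldesc[of a b c u] n distinct3_exhaust[OF d] by blast
    then show ?thesis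
    proof (elim disjE)
      assume u: "ldesc u = {a, b}"
      have "k \<ge> 3" using ldesc_two_strip(3)[OF d u] k(2) by simp
      then obtain j where j: "l = Suc j" using l by (cases l) auto
      \<comment> \<open>The correction cancels [u \<le> x] here: stripping the braid b a b reduces
        the inequality with \<open>x\<close> to one with \<open>zig j c a b\<close>, and putting it
        back gives the one with the coatom.\<close>
      have "u \<le> x \<longleftrightarrow> u \<le> zig_top j a b c"
      proof
        assume "u \<le> zig_top j a b c"
        also have "\<dots> \<le> x" using zig_top(4)[OF d, of j] by (simp add: x_def k l j)
        finally show "u \<le> x" .
      next
        let ?y = "zig j c a b"
        assume "u \<le> x"
        then have "gen b * (gen a * (gen b * u)) \<le> ?y"
          using le_zig_two_descents_iff[OF d u, of j] by (simp add: x_def k l j)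
        moreover have "b \<notin> ldesc ?y" by (rule not_ldesc_zig(2)[OF rot(2)])
        moreover have "a \<notin> ldesc (gen b * ?y)"
          using not_ldesc_zig(2)[OF rot(1), of "Suc j"] by (simp add: zig_Suc)
        moreover have "b \<notin> ldesc (gen a * (gen b * ?y))"
          using not_ldesc_zig(1)[OF d, of "Suc (Suc j)"] by (simp add: zig_Suc)
        ultimately have "gen b * (gen a * (gen b * (gen b * (gen a * (gen b * u))))) \<le> zig_top j a b c"
          unfolding zig_top_def by (intro lift_up)
        then show "u \<le> zig_top j a b c" by simp
      qed
      then have "(if u \<le> x then 1 else 0) = int (card N)" by (simp add: N j)
      moreover have "ldesc (gen a * u) = {b}" by (rule ldesc_gen_mult_two[of a b c]) (use n u in auto)
      then have "ldesc (gen a * u) \<noteq> {b, a}" using n by auto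
      moreover have "u \<noteq> zig k a b c" "ldesc u \<noteq> {a, c}" using u uk n by auto
      ultimately show ?thesis unfolding w rec IH zigk mk by simp
    next
      \<comment> \<open>Nothing cancels [u \<le> x] here: \<open>gen a * u\<close> has the single
        descent c, which makes the recursive term vanish, and the coatom does not lie above
        \<open>u\<close>.\<close>
      assume u: "ldesc u = {a, c}"
      have "ldesc (gen a * u) = {c}" by (rule ldesc_gen_mult_two[of a c b]) (use n u in auto)
      then have "b \<notin> ldesc (gen a * u)" using n by simp
      then have "ldesc (gen a * u) \<noteq> {b, a}" by blast
      moreover have ne: "u \<noteq> zig k a b c"
      proof
        assume "u = zig k a b c"
        then have "{a, c} = {a}" using u uk by simp
        then show False using n by auto
      qed
      moreover have bnu: "b \<notin> ldesc u" using u n by simp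
      then have "card N = 0" unfolding N using bu[OF bnu] ne by auto
      ultimately show ?thesis using u ux[OF bnu] unfolding w rec IH zigk mk by simp
    next
      \<comment> \<open>Only \<open>u = zig k a b c\<close> can contribute. For l \<ge> 1 the
        recursive term is 1 and the other two cancel; for l = 0 the 1 comes from [u \<le> x], which
        starts the family in c_1.\<close>
      assume u: "ldesc u = {a}"
      have b: "b \<notin> ldesc u" "c \<notin> ldesc u" using u n by auto
      have "u \<le> zig (Suc k) c a b \<longleftrightarrow> u = zig k a b c"
      proof
        assume "u \<le> zig (Suc k) c a b"
        then have "u \<le> zig k a b c"
          using lift_strip[of u "zig (Suc k) c a b" c] b ldesc_zig_Suc[OF rot(2), of k] by (simp add: x(2))
        then show "u = zig k a b c" using k(2) len_zig[OF d] by (intro bruhat_le_len_eq) auto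
      next
        assume "u = zig k a b c"
        then show "u \<le> zig (Suc k) c a b"
          unfolding x(2) using lift_weaken[of u "zig k a b c" c] not_ldesc_zig(2)[OF d] by auto
      qed
      then have "u \<le> x \<longleftrightarrow> u = zig k a b c" using ux[OF b(1)] by simp
      moreover have "u \<le> zig_top (l - 1) a b c" if "u = zig k a b c" "l \<ge> 1"
      proof -
        have "b \<in> ldesc (zig_top (l - 1) a b c)" using zig_top(1)[OF d] by simp
        then have "gen b * zig_top (l - 1) a b c \<le> zig_top (l - 1) a b c"
          by (simp add: gen_mult_le_iff ldesc_def)
        then show ?thesis using that top by simp
      qed
      then have "1 \<le> l \<and> u \<le> zig_top (l - 1) a b c \<longleftrightarrow> 1 \<le> l \<and> u = zig k a b c"
        using bu[OF b(1)] by blast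
      then have "card N = (if 1 \<le> l \<and> u = zig k a b c then 1 else 0)"
        unfolding N by simp
      moreover have "ldesc (gen a * u) \<noteq> {b, a}" using anu by blast
      moreover have "ldesc u \<noteq> {a, c}" using u n by auto
      moreover have "4 \<le> Suc m" using k l by simp
      ultimately show ?thesis unfolding w rec IH zigk mk by simp
    qed
  qed
qed simp


text \<open>The three differences add up to 0, so the bounds cut out a triangle around the
  fundamental alcove, where all differences vanish. A left factor permutes the differences up to
  shifts by 3, so each further letter enlarges the triangle in a controlled way.\<close>

lemma pt_le_zig:
  assumes "distinct3 a b c" "v \<le> zig n a b c"
  shows "pt v b - pt v a \<le> 3 * int (Suc n div 2) \<and> pt v c - pt v b \<le> 3 * int (n div 2) \<and>
    pt v a - pt v c \<le> 3 * int (n div 2)"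
  using assms
proof (induction n arbitrary: a b c v)
  case (Suc n)
  note d = Suc.prems(1) and n = distinct3D[OF Suc.prems(1)]
  have h: "int (Suc (Suc n) div 2) = int (n div 2) + 1" "int (n div 2) \<le> int (Suc n div 2)" by auto
  have "v \<le> zig n b c a \<or> gen a * v \<le> zig n b c a"
    using le_gen_multD[of v a "zig n b c a"] Suc.prems(2) not_ldesc_zig(2)[OF distinct3_rotate(1)[OF d]]
    by (auto simp: zig_Suc)
  then show ?case
  proof
    assume "v \<le> zig n b c a"
    from Suc.IH[OF distinct3_rotate(1)[OF d] this] show ?thesis unfolding h using h(2) by auto
  next
    assume "gen a * v \<le> zig n b c a"
    from Suc.IH[OF distinct3_rotate(1)[OF d] this] show ?thesis
      unfolding h using h(2) pt_sum[of a b c v] n by (auto simp: pt_gen_mult_simps)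
  qed
qed simp

text \<open>The witness is the product with its last but one letter deleted, so that it ends in a
  braid. It attains the bound of \<open>pt_le_zig\<close> on \<open>pt v c - pt v b\<close>.\<close>

lemma zig_corner_exists:
  assumes "distinct3 a b c"
  shows "\<exists>v. v \<le> zig (2 * j + 4) a b c \<and> pt v a = - 1 - 3 * int j \<and> pt v b = - 1 \<and> pt v c = 5 + 3 * int j"
  using assms
proof (induction j arbitrary: a b c)
  case 0
  note n = distinct3D[OF 0] and rot = distinct3_rotate[OF 0]
  have zig: "zig (2 * 0 + 4) a b c = gen a * (gen b * (gen c * (gen a * 1)))"
    by (simp add: numeral_eq_Suc zig_Suc)
  have nd: "c \<notin> ldesc (zig 1 a b c)" "b \<notin> ldesc (zig 2 c a b)" "a \<notin> ldesc (zig 3 b c a)"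
    using not_ldesc_zig(2)[OF 0] not_ldesc_zig(2)[OF rot(1)] not_ldesc_zig(2)[OF rot(2)] by auto
  have "gen a * 1 \<le> gen c * (gen a * 1)"
    using lift_weaken[OF order_refl nd(1)] by (simp add: zig_Suc)
  then have "gen a * (gen b * (gen a * 1)) \<le> gen a * (gen b * (gen c * (gen a * 1)))"
    using nd by (intro lift_up) (simp_all add: zig_Suc numeral_eq_Suc)
  then show ?case
    using n by (intro exI[of _ "gen a * (gen b * (gen a * 1))"])
      (simp only: zig, simp add: pt_gen_mult_simps del: mult_1_right)
next
  case (Suc j)
  note n = distinct3D[OF Suc.prems] and rot = distinct3_rotate[OF Suc.prems]
  obtain v where v: "v \<le> zig (2 * j + 4) c a b" "pt v c = - 1 - 3 * int j" "pt v a = - 1" "pt v b = 5 + 3 * int j"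
    using Suc.IH[OF rot(2)] by blast
  have "gen a * (gen b * v) \<le> gen a * (gen b * zig (2 * j + 4) c a b)"
    using v(1) not_ldesc_zig(2)[OF rot(2), of "2 * j + 4"] not_ldesc_zig(2)[OF rot(1), of "Suc (2 * j + 4)"]
    unfolding zig_Suc[of "2 * j + 4" b c a] by (intro lift_up)
  moreover have "zig (2 * Suc j + 4) a b c = gen a * (gen b * zig (2 * j + 4) c a b)"
    by (simp add: zig_Suc numeral_eq_Suc)
  ultimately show ?case
    using n v by (intro exI[of _ "gen a * (gen b * v)"]) (simp add: pt_gen_mult_simps)
qed

section \<open>Right descents and the position of an alcove in its sector\<close>

definition rdesc :: "weyl \<Rightarrow> letter set" where
  "rdesc w = {a. len (w * gen a) < len w}"

lemma div3_eqs:
  fixes i :: int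
  shows "(1 - 3 * i) div 3 = - i" "(- 1 - 3 * i) div 3 = - i - 1" "(- 2 - 3 * i) div 3 = - i - 1"
    "(- 4 - 3 * i) div 3 = - i - 2"
  by presburger+

lemma third_third: "third a (third a y) = y"
  by (cases a; cases y; simp add: third_def)

lemma inj_foldr_third: "inj (foldr third xs)"
proof (induction xs)
  case (Cons a xs)
  have "inj (third a)" by (rule inj_on_inverseI[of _ "third a"]) (rule third_third)
  from inj_compose[OF this Cons] show ?case by (simp add: comp_def)
qed (simp add: inj_on_def)

text \<open>Alcoves in a sector opposite to the fundamental one come in two orientations; those of odd
  length have two right descents and the others one.\<close>

lemma rdesc_sector:
  assumes d: "distinct3 a b c" and u: "ldesc u = {a, c}" and xs: "word xs = u"
  obtains i j :: nat where
    "odd (len u)" "len u = 2 * (i + j) + 3" "pt u a = - 1 - 3 * int i" "pt u c = - 1 - 3 * int j"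
    "pt u b = 5 + 3 * int i + 3 * int j" "rdesc u = {y. foldr third xs y \<noteq> b}"
  | i j :: nat where
    "even (len u)" "len u = 2 * (i + j) + 4" "pt u a = - 2 - 3 * int i" "pt u c = - 2 - 3 * int j"
    "pt u b = 7 + 3 * int i + 3 * int j" "rdesc u = {y. foldr third xs y = b}"
proof -
  note n = distinct3D[OF d]
  have neg: "pt u a < 0" "pt u c < 0" using u by (auto simp flip: ldesc_iff_pt)
  have sum: "pt u a + pt u b + pt u c = 3" using n by (intro pt_sum) auto
  have par: "even (len u) = even (length xs)" by (simp add: even_len even_elt_word flip: xs)
  have md: "pt u x mod 3 = (if even (len u) then 1 else 2)" for x by (simp add: pt_mod3 even_len)
  have len: "int (len w) = \<bar>pt w a div 3\<bar> + \<bar>pt w c div 3\<bar> + \<bar>(pt w a + pt w c) div 3\<bar>" for w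
    using n by (intro len_pt[of a c b]) auto
  have R: "pt (u * gen y) x = pt u x + (- 1) ^ length xs * edge_vec (foldr third xs y) x" for x y
    using pt_word_mult_gen[of xs y x] by (simp add: xs)
  show thesis
  proof (cases "even (len u)")
    case False
    \<comment> \<open>Coordinates are 2 modulo 3 for odd length, so the negative ones have the form
      -1 - 3i; for even length they are 1 modulo 3, whence -2 - 3i below.\<close>
    define i j where "i = nat ((- 1 - pt u a) div 3)" and "j = nat ((- 1 - pt u c) div 3)"
    have ij: "pt u a = - 1 - 3 * int i" "pt u c = - 1 - 3 * int j"
      using neg md[of a] md[of c] False unfolding i_def j_def by (simp_all) presburger+
    have s: "- 1 - 3 * int i + (- 1 - 3 * int j) = - 2 - 3 * (int i + int j)" by simp
    have lu: "int (len u) = 2 * (int i + int j) + 3"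
      unfolding len[of u] ij s div3_eqs by simp
    \<comment> \<open>The lengths of the three neighbours are compared by counting walls. Only the
      step opposite to \<open>edge_vec b\<close> makes both negative coordinates more
      negative.\<close>
    have "y \<in> rdesc u \<longleftrightarrow> foldr third xs y \<noteq> b" for y
    proof -
      define p where "p = foldr third xs y"
      have R': "pt (u * gen y) x = pt u x - edge_vec p x" for x
        using R[of y x] par False by (simp add: p_def)
      consider "p = a" | "p = b" | "p = c" using distinct3_exhaust[OF d] by blast
      then show ?thesis
      proof cases
        case 1
        then have "pt (u * gen y) a = 1 - 3 * int i" "pt (u * gen y) c = - 2 - 3 * int j"
          using n by (simp_all add: R' ij edge_vec_def)
        moreover have "1 - 3 * int i + (- 2 - 3 * int j) = - 1 - 3 * (int i + int j)" by simp
        ultimately have "int (len (u * gen y)) = 2 * (int i + int j) + 2"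
          unfolding len[of "u * gen y"] by (simp only: div3_eqs)
        then show ?thesis using lu 1 n by (simp add: rdesc_def p_def)
      next
        case 2
        then have "pt (u * gen y) a = - 2 - 3 * int i" "pt (u * gen y) c = - 2 - 3 * int j"
          using n by (simp_all add: R' ij edge_vec_def)
        moreover have "- 2 - 3 * int i + (- 2 - 3 * int j) = - 4 - 3 * (int i + int j)" by simp
        ultimately have "int (len (u * gen y)) = 2 * (int i + int j) + 4"
          unfolding len[of "u * gen y"] by (simp only: div3_eqs)
        then show ?thesis using lu 2 n by (simp add: rdesc_def p_def)
      next
        case 3
        then have "pt (u * gen y) a = - 2 - 3 * int i" "pt (u * gen y) c = 1 - 3 * int j"
          using n by (simp_all add: R' ij edge_vec_def)
        moreover have "- 2 - 3 * int i + (1 - 3 * int j) = - 1 - 3 * (int i + int j)" by simp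
        ultimately have "int (len (u * gen y)) = 2 * (int i + int j) + 2"
          unfolding len[of "u * gen y"] by (simp only: div3_eqs)
        then show ?thesis using lu 3 n by (simp add: rdesc_def p_def)
      qed
    qed
    then show thesis using that(1)[of i j] False ij lu sum by auto
  next
    case True
    define i j where "i = nat ((- 2 - pt u a) div 3)" and "j = nat ((- 2 - pt u c) div 3)"
    have ij: "pt u a = - 2 - 3 * int i" "pt u c = - 2 - 3 * int j"
      using neg md[of a] md[of c] True unfolding i_def j_def by (simp_all) presburger+
    have s: "- 2 - 3 * int i + (- 2 - 3 * int j) = - 4 - 3 * (int i + int j)" by simp
    have lu: "int (len u) = 2 * (int i + int j) + 4"
      unfolding len[of u] ij s div3_eqs by simp
    have "y \<in> rdesc u \<longleftrightarrow> foldr third xs y = b" for y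
    proof -
      define p where "p = foldr third xs y"
      have R': "pt (u * gen y) x = pt u x + edge_vec p x" for x
        using R[of y x] par True by (simp add: p_def)
      consider "p = a" | "p = b" | "p = c" using distinct3_exhaust[OF d] by blast
      then show ?thesis
      proof cases
        case 1
        then have "pt (u * gen y) a = - 4 - 3 * int i" "pt (u * gen y) c = - 1 - 3 * int j"
          using n by (simp_all add: R' ij edge_vec_def)
        moreover have "- 4 - 3 * int i + (- 1 - 3 * int j) = - 2 - 3 * (int i + int j + 1)" by simp
        ultimately have "int (len (u * gen y)) = 2 * (int i + int j) + 5"
          unfolding len[of "u * gen y"] by (simp only: div3_eqs) simp
        then show ?thesis using lu 1 n by (simp add: rdesc_def p_def)
      next
        case 2
        then have "pt (u * gen y) a = - 1 - 3 * int i" "pt (u * gen y) c = - 1 - 3 * int j"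
          using n by (simp_all add: R' ij edge_vec_def)
        moreover have "- 1 - 3 * int i + (- 1 - 3 * int j) = - 2 - 3 * (int i + int j)" by simp
        ultimately have "int (len (u * gen y)) = 2 * (int i + int j) + 3"
          unfolding len[of "u * gen y"] by (simp only: div3_eqs)
        then show ?thesis using lu 2 n by (simp add: rdesc_def p_def)
      next
        case 3
        then have "pt (u * gen y) a = - 1 - 3 * int i" "pt (u * gen y) c = - 4 - 3 * int j"
          using n by (simp_all add: R' ij edge_vec_def)
        moreover have "- 1 - 3 * int i + (- 4 - 3 * int j) = - 2 - 3 * (int i + int j + 1)" by simp
        ultimately have "int (len (u * gen y)) = 2 * (int i + int j) + 5"
          unfolding len[of "u * gen y"] by (simp only: div3_eqs) simp
        then show ?thesis using lu 3 n by (simp add: rdesc_def p_def)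
      qed
    qed
    then show thesis using that(2)[of i j] True ij lu sum by auto
  qed
qed

lemma letter_index_zigs:
  assumes "distinct3 a b c" "i < n" shows "letter_index a b (zigs n a b c ! i) = int i mod 3"
proof -
  have "zigs n a b c ! i = (if i mod 3 = 0 then a else if i mod 3 = 1 then b else c)"
    if "distinct3 a b c" "i < n" for a b c i n
    using that
  proof (induction n arbitrary: a b c i)
    case (Suc n)
    show ?case
    proof (cases i)
      case (Suc i')
      then have "zigs n b c a ! i' = (if i' mod 3 = 0 then b else if i' mod 3 = 1 then c else a)"
        using Suc.IH[OF distinct3_rotate(1)[OF Suc.prems(1)], of i'] Suc.prems(2) by simp
      moreover have "i' mod 3 = 0 \<or> i' mod 3 = 1 \<or> i' mod 3 = 2" by presburger
      ultimately show ?thesis using Suc by (auto simp: mod_Suc)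
    qed simp
  qed simp
  then have "zigs n a b c ! i = (if i mod 3 = 0 then a else if i mod 3 = 1 then b else c)"
    using assms by blast
  moreover have "i mod 3 = 0 \<or> i mod 3 = 1 \<or> i mod 3 = 2" by presburger
  moreover have "int i mod 3 = int (i mod 3)" by (simp add: zmod_int)
  ultimately show ?thesis
    using distinct3D[OF assms(1)] by (auto simp: letter_index_def simp del: of_nat_mod)
qed

lemma letter_index_inject:
  assumes "distinct3 a b c" "letter_index a b x = letter_index a b y" shows "x = y"
  using assms distinct3_exhaust[OF assms(1), of x] distinct3_exhaust[OF assms(1), of y]
  by (auto simp: letter_index_def split: if_splits)

lemma card_letters: "card (UNIV :: letter set) = 3"
proof -
  have UNIV: "(UNIV :: letter set) = {Lr, Ls, Lt}" using letter.exhaust by auto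
  show ?thesis unfolding UNIV by simp
qed

lemma finite_letters: "finite (A :: letter set)"
  by (rule finite_subset[of _ "{Lr, Ls, Lt}"]) (use letter.exhaust in auto)

text \<open>For odd length both sides amount to i = 0. For even length both fail, the left side by
  the coordinate bound and the right side because R(u) is a singleton.\<close>

lemma le_zig_iff_rdesc:
  assumes d: "distinct3 a b c" and u: "ldesc u = {a, c}" and le: "u \<le> zig n a b c" and n: "len u + 3 = n"
  shows "u \<le> zig (n - 2) c a b \<longleftrightarrow>
    card (rdesc u) = 2 \<and> zigs n a b c ! (n - 1) \<in> rdesc u \<and> zigs n a b c ! (n - 2) \<notin> rdesc u"
    (is "?L \<longleftrightarrow> ?R")
proof -
  note dd = distinct3D[OF d] and rot = distinct3_rotate[OF d]
  obtain xs where xs: "word xs = u" by (metis word_surj)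
  have "bij (foldr third xs)"
    by (rule finite_UNIV_inj_surj[OF finite_letters inj_foldr_third, THEN bij_betw_imageI[OF inj_foldr_third]])
  then obtain y0 where y0: "foldr third xs y0 = b" by (metis bij_pointE)
  have y0_iff: "foldr third xs y = b \<longleftrightarrow> y = y0" for y
    using y0 inj_foldr_third[of xs] by (auto dest: injD)
  show ?thesis
  proof (rule rdesc_sector[OF d u xs])
    fix i j :: nat
    assume o: "odd (len u)" and l: "len u = 2 * (i + j) + 3"
      and p: "pt u a = - 1 - 3 * int i" "pt u c = - 1 - 3 * int j" "pt u b = 5 + 3 * int i + 3 * int j"
      and r: "rdesc u = {y. foldr third xs y \<noteq> b}"
    have rdesc: "rdesc u = UNIV - {y0}" unfolding r y0_iff by auto
    then have card: "card (rdesc u) = 2" by (simp add: card_letters finite_letters)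
    have nij: "n = 2 * (i + j) + 6" using n l by simp
    have "even_elt u = even (length xs)" by (simp add: even_elt_word flip: xs)
    then have "odd (length xs)" using o by (simp add: even_len)
    then have "3 * letter_index a b b mod 9 = (pt u b + 2 * pt u c + 3 - 3 * letter_index a b y0) mod 9"
      using letter_index_foldr_third[OF dd(1-3), of xs y0] by (simp add: y0 xs)
    \<comment> \<open>Divided by 3, this says that the letter \<open>y0\<close> outside R(u) has
      index 1 + i - j modulo 3.\<close>
    then have idx: "3 mod 9 = (6 + 3 * int i - 3 * int j - 3 * letter_index a b y0) mod (9 :: int)"
      using dd by (simp add: p letter_index_def algebra_simps)
    have idx_n: "letter_index a b (zigs n a b c ! (n - 2)) = int (n - 2) mod 3"
      using nij by (intro letter_index_zigs[OF d]) auto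
    have y0_eq: "zigs n a b c ! (n - 2) = y0 \<longleftrightarrow> i mod 3 = 0"
    proof -
      have "zigs n a b c ! (n - 2) = y0 \<longleftrightarrow> letter_index a b y0 = int (n - 2) mod 3"
        using letter_index_inject[OF d] idx_n by metis
      also have "\<dots> \<longleftrightarrow> i mod 3 = 0"
      proof -
        obtain k where "3 - (6 + 3 * int i - 3 * int j - 3 * letter_index a b y0) = 9 * k"
          using idx unfolding mod_eq_dvd_iff by (elim dvdE)
        then have "letter_index a b y0 = 1 + int i - int j + 3 * k" by simp
        then have "letter_index a b y0 mod 3 = (1 + int i - int j) mod 3" by (simp only: mod_mult_self2)
        moreover have "letter_index a b y0 mod 3 = letter_index a b y0" by (simp add: letter_index_def)
        moreover have "int (n - 2) = 2 * int i + 2 * int j + 4" using nij by simp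
        ultimately have "letter_index a b y0 = int (n - 2) mod 3 \<longleftrightarrow>
            3 dvd (1 + int i - int j) - (2 * int i + 2 * int j + 4)"
          by (simp only: mod_eq_dvd_iff)
        \<comment> \<open>Modulo 3 the coordinate j drops out of the comparison with position n - 2,
          which leaves only -i.\<close>
        also have "(1 + int i - int j) - (2 * int i + 2 * int j + 4) = - int i + 3 * (- int j - 1)" by simp
        also have "3 dvd \<dots> \<longleftrightarrow> 3 dvd - int i" by (rule dvd_add_left_iff) simp
        also have "\<dots> \<longleftrightarrow> i mod 3 = 0" by (simp add: mod_eq_0_iff_dvd) presburger
        finally show ?thesis .
      qed
      finally show ?thesis .
    qed
    \<comment> \<open>The inequality with the full product is what makes the residue of i modulo 3
      decide whether i = 0.\<close>
    have i1: "i \<le> 1" using pt_le_zig[OF d le] by (simp add: p nij)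
    have "?L \<longleftrightarrow> i = 0"
    proof
      assume ?L
      \<comment> \<open>The second bound for the rotated triple reads 6 + 6i + 3j \<le> 3(i + j +
        2).\<close>
      from pt_le_zig[OF rot(2) this] show "i = 0" by (simp add: p nij)
    next
      assume i: "i = 0"
      \<comment> \<open>For i = 0 the alcove of \<open>u\<close> is the corner, and coordinates
        determine the element.\<close>
      obtain v where v: "v \<le> zig (2 * j + 4) c a b" "pt v c = - 1 - 3 * int j" "pt v a = - 1" "pt v b = 5 + 3 * int j"
        using zig_corner_exists[OF rot(2), of j] by blast
      have "pt u x = pt v x" for x
        using distinct3_exhaust[OF d, of x] v p by (auto simp: i)
      then have "u = v" by (simp flip: pt_inject add: fun_eq_iff)
      moreover have "n - 2 = 2 * j + 4" by (simp add: nij i)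
      ultimately show ?L using v(1) by simp
    qed
    moreover have "zigs n a b c ! (n - 1) \<noteq> zigs n a b c ! (n - 2)"
    proof
      assume "zigs n a b c ! (n - 1) = zigs n a b c ! (n - 2)"
      then have "int (n - 1) mod 3 = int (n - 2) mod 3"
        using letter_index_zigs[OF d, of "n - 1" n] idx_n nij by simp
      moreover have "int (n - 1) = int (n - 2) + 1" using nij by simp
      ultimately show False by presburger
    qed
    moreover have "i = 0 \<longleftrightarrow> i mod 3 = 0" using i1 by auto
    ultimately have "?L \<longleftrightarrow> zigs n a b c ! (n - 2) = y0" "zigs n a b c ! (n - 1) \<noteq> zigs n a b c ! (n - 2)"
      using y0_eq by simp_all
    then show ?thesis unfolding card unfolding rdesc by (metis DiffE DiffI UNIV_I insertI1 singletonD)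
  next
    fix i j :: nat
    assume o: "even (len u)" and l: "len u = 2 * (i + j) + 4"
      and p: "pt u a = - 2 - 3 * int i" "pt u c = - 2 - 3 * int j" "pt u b = 7 + 3 * int i + 3 * int j"
      and r: "rdesc u = {y. foldr third xs y = b}"
    have "rdesc u = {y0}" unfolding r y0_iff by auto
    moreover have "\<not> ?L"
    proof
      assume ?L
      \<comment> \<open>The bound would require 9 + 6i + 3j \<le> 3(i + j + 2).\<close>
      moreover have "(n - 2) div 2 = i + j + 2" using n l by simp
      ultimately show False using pt_le_zig[OF rot(2), of u "n - 2"] by (simp add: p)
    qed
    ultimately show ?thesis by simp
  qed
qed

text \<open>The first letter of a reduced word is a left descent, and an alternating product has
  only one; the same holds after it is removed.\<close>

lemma zig_reduced_unique:
  assumes "distinct3 a b c" "word ys = zig n a b c" "length ys = n"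
  shows "ys = zigs n a b c"
  using assms
proof (induction n arbitrary: a b c ys)
  case (Suc n)
  then obtain y ys' where ys: "ys = y # ys'" by (cases ys) auto
  then have "gen y * zig (Suc n) a b c = word ys'" using Suc.prems(2) by (metis gen_sq_assoc word_simps(2))
  then have "len (gen y * zig (Suc n) a b c) < len (zig (Suc n) a b c)"
    using len_word_le[of ys'] Suc.prems ys by (simp add: len_zig)
  then have "y \<in> ldesc (zig (Suc n) a b c)" by (simp add: ldesc_def)
  then have y: "y = a" using ldesc_zig_Suc[OF Suc.prems(1)] by simp
  then have "word ys' = zig n b c a" using Suc.prems(2) ys by (simp add: zig_Suc gen_mult_eq_iff)
  then show ?case using Suc.IH[OF distinct3_rotate(1)[OF Suc.prems(1)], of ys'] Suc.prems(3) ys y by simp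
qed simp

lemma zig_notin_cell0:
  assumes "distinct3 a b c" shows "zig n a b c \<notin> cell0"
proof (cases "zig n a b c = 1")
  case False
  have "\<exists>!xs. reduced_expr xs (zig n a b c)"
  proof (rule ex1I)
    show "reduced_expr (map gen (zigs n a b c)) (zig n a b c)"
      unfolding reduced_expr_map using len_zig[OF assms] by (auto simp: zig_def)
    fix xs assume "reduced_expr xs (zig n a b c)"
    then show "xs = map gen (zigs n a b c)"
      unfolding reduced_expr_map using zig_reduced_unique[OF assms] len_zig[OF assms] by auto
  qed
  then show ?thesis using False by (simp add: cell0_def cell1_def)
qed (simp add: cell0_def)

text \<open>Each letter differs from the two distinct letters before it, and with three letters in
  all it is forced.\<close>

lemma braid_free_eq_zigs:
  assumes "\<And>xs p zs. ys \<noteq> xs @ [p, p] @ zs" "\<And>xs p q zs. ys \<noteq> xs @ [p, q, p] @ zs" "ys = a # b # rest"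
  shows "ys = zigs (length ys) a b (third a b)"
  using assms
proof (induction ys arbitrary: a b rest)
  case (Cons y ys)
  have ab: "y = a" "ys = b # rest" "a \<noteq> b" using Cons.prems(3) Cons.prems(1)[of "[]"] by auto
  show ?case
  proof (cases rest)
    case Nil
    then show ?thesis using ab by simp
  next
    case (Cons c rest')
    have "b \<noteq> c" "a \<noteq> c" using Cons.prems(1)[of "[a]" b rest'] Cons.prems(2)[of "[]" a b rest'] ab Cons by auto
    then have c: "third a b = c" "third b c = a" using ab by (auto intro: third_eq)
    have "ys = zigs (length ys) b c (third b c)"
    proof (rule Cons.IH)
      show "ys \<noteq> xs @ [p, p] @ zs" for xs p zs using Cons.prems(1)[of "y # xs" p zs] by simp
      show "ys \<noteq> xs @ [p, q, p] @ zs" for xs p q zs using Cons.prems(2)[of "y # xs" p q zs] by simp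
      show "ys = b # c # rest'" using ab Cons by simp
    qed
    then show ?thesis using c ab by simp
  qed
qed simp

text \<open>A factor pp would allow a shorter word, and a factor pqp a second reduced word through
  the braid relation.\<close>

lemma cell1_word_zigs:
  assumes w: "w \<in> cell1" and ys: "word ys = w" "length ys = len w" "length ys \<ge> 3"
  obtains a b c where "distinct3 a b c" "ys = zigs (length ys) a b c"
proof -
  have uniq: "zs = ys" if "word zs = w" "length zs = len w" for zs
  proof -
    have "reduced_expr (map gen zs) w" "reduced_expr (map gen ys) w"
      using that ys by (auto simp: reduced_expr_map)
    then have "map gen zs = map gen ys" using w by (auto simp: cell1_def)
    then show ?thesis by (metis gen_inject inj_def inj_map_eq_map)
  qed
  have 1: "ys \<noteq> xs @ [p, p] @ zs" for xs p zs
  proof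
    assume eq: "ys = xs @ [p, p] @ zs"
    then have "word (xs @ zs) = w" using ys(1) by simp
    then show False using len_word_le[of "xs @ zs"] ys(2) eq by simp
  qed
  have 2: "ys \<noteq> xs @ [p, q, p] @ zs" for xs p q zs
  proof
    assume eq: "ys = xs @ [p, q, p] @ zs"
    show False
    proof (cases "p = q")
      case True
      then show ?thesis using eq 1[of xs p "p # zs"] by simp
    next
      case False
      then have "word (xs @ [q, p, q] @ zs) = w"
        using ys(1) eq gen_braid_assoc[OF False, of "word zs"] by simp
      moreover have "length (xs @ [q, p, q] @ zs) = len w" using eq ys(2) by simp
      ultimately have "xs @ [q, p, q] @ zs = ys" by (rule uniq)
      then show ?thesis using eq False by simp
    qed
  qed
  obtain a b rest where r: "ys = a # b # rest" using ys(3) by (cases ys; cases "tl ys") auto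
  then have "a \<noteq> b" using 1[of "[]" a rest] by auto
  then have "distinct3 a b (third a b)" by (cases a; cases b; simp add: distinct3_def third_def)
  then show thesis using that braid_free_eq_zigs[OF 1 2 r] by blast
qed

lemma left_desc_eq: "left_desc u = gen ` ldesc u"
proof -
  have "gen a * u < u \<longleftrightarrow> a \<in> ldesc u" for a
    using gen_mult_le_iff[of a u] by (auto simp: less_le ldesc_def)
  then show ?thesis unfolding left_desc_def simple_refls_eq by auto
qed

lemma right_desc_eq: "right_desc u = gen ` rdesc u"
proof -
  have "u * gen a < u \<longleftrightarrow> a \<in> rdesc u" for a
  proof
    assume "a \<in> rdesc u"
    then have "bruhat_step (u * gen a) u"
      by (auto simp: bruhat_step_def rdesc_def intro!: bexI[of _ "gen a"])
    then show "u * gen a < u"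
      using \<open>a \<in> rdesc u\<close> by (auto simp: less_weyl_def less_eq_weyl_def rdesc_def)
  qed (simp add: rdesc_def bruhat_less_len)
  then show ?thesis unfolding right_desc_def simple_refls_eq by auto
qed

theorem theorem5p12:
  fixes w u :: weyl and s :: "weyl list" and n :: nat
  assumes "w \<in> cell1"
    and "reduced_expr s w" and "length s = n"
    and "n \<ge> 3" and "{s ! 0, s ! 1, s ! 2} = simple_refls"
    and "u \<in> cell0_below w 3"
  shows "(kl_mu u w \<noteq> 0 \<longleftrightarrow>
            card (left_desc u) = 2 \<and> card (right_desc u) = 2 \<and>
            s ! 0 \<in> left_desc u \<and> s ! (n - 1) \<in> right_desc u \<and>
            s ! 1 \<notin> left_desc u \<and> s ! (n - 2) \<notin> right_desc u) \<and>
         (kl_mu u w \<noteq> 0 \<longrightarrow> kl_mu u w = 1)"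
proof -
  obtain ys where ys: "s = map gen ys" "word ys = w" "length ys = len w"
    using assms(2) by (auto simp: reduced_expr_map)
  have len_ys: "length ys = n" using assms(3) ys(1) by simp
  obtain a b c where d: "distinct3 a b c" and zigs: "ys = zigs n a b c"
    using cell1_word_zigs[OF assms(1) ys(2,3)] assms(4) len_ys by auto
  note dd = distinct3D[OF d]
  have w: "w = zig n a b c" using ys(2) zigs by (simp add: zig_def)
  have u: "u \<in> cell0" "u \<le> zig n a b c" "len u + 3 = n"
    using assms(6) ys(3) len_ys by (auto simp: cell0_below_def w)
  \<comment> \<open>For length difference 3, \<mu> is the coefficient of the first power of
    q.\<close>
  have "len w - len u = 3" using u(3) ys(3) len_ys by simp
  then have "kl_mu u w = coeff (kl_poly u (zig n a b c)) 1" by (simp add: kl_mu_def w)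
  \<comment> \<open>The alternating product of length n - 3 is ruled out because \<open>u\<close>
    lies in c_0.\<close>
  also have "\<dots> = (if ldesc u = {a, c} \<and> u \<le> zig (n - 2) c a b then 1 else 0)"
    using coeff_1_zig[OF d u(2,3)] zig_notin_cell0[OF d, of "n - 3"] u(1) by auto
  finally have mu: "kl_mu u w = (if ldesc u = {a, c} \<and> u \<le> zig (n - 2) c a b then 1 else 0)" .
  have inj: "inj gen" by (simp add: inj_def)
  have nth: "s ! i = gen (zigs n a b c ! i)" if "i < n" for i
    using that by (simp add: ys(1) zigs)
  have "zigs n a b c ! 0 = a" "zigs n a b c ! 1 = b"
    using assms(4) by (cases n; simp; cases "n - 1"; simp)+
  then have s01: "s ! 0 = gen a" "s ! 1 = gen b" using nth[of 0] nth[of 1] assms(4) by simp_all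
  have "ldesc u = {a, c} \<longleftrightarrow> card (ldesc u) = 2 \<and> a \<in> ldesc u \<and> b \<notin> ldesc u"
  proof
    assume *: "card (ldesc u) = 2 \<and> a \<in> ldesc u \<and> b \<notin> ldesc u"
    then have "ldesc u \<subseteq> {a, c}" using distinct3_exhaust[OF d] by blast
    moreover have "card {a, c} = 2" using dd by simp
    ultimately show "ldesc u = {a, c}" using * by (intro card_subset_eq) auto
  qed (use dd in auto)
  moreover have "card (left_desc u) = card (ldesc u)" "card (right_desc u) = card (rdesc u)"
    using inj by (simp_all add: left_desc_eq right_desc_eq card_image inj_on_subset)
  moreover have "s ! 0 \<in> left_desc u \<longleftrightarrow> a \<in> ldesc u" "s ! 1 \<in> left_desc u \<longleftrightarrow> b \<in> ldesc u"
    using inj unfolding s01 left_desc_eq by (simp_all add: inj_image_mem_iff)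
  moreover have "s ! (n - 1) \<in> right_desc u \<longleftrightarrow> zigs n a b c ! (n - 1) \<in> rdesc u"
    "s ! (n - 2) \<in> right_desc u \<longleftrightarrow> zigs n a b c ! (n - 2) \<in> rdesc u"
    using inj assms(4) nth[of "n - 1"] nth[of "n - 2"] by (simp_all add: right_desc_eq inj_image_mem_iff)
  ultimately show ?thesis
    using le_zig_iff_rdesc[OF d _ u(2,3)] unfolding mu by auto
qed

end
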